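(* Let $\mu$ be a non-zero Borel measure on $\mathbb{R}$ supported on a compact set $\Gamma\subset\mathbb{R}$, with a density $\rho\in W^{1,p}(\mathbb{R})$ for some $1<p<\infty$ (that is, $\mathrm{d}\mu(x)=\rho(x)\,\mathrm{d}x$, with $\rho\ge 0$ taken to be its absolutely continuous representative). Let $S\subset\mathbb{R}$ be an arbitrary nowhere dense set and let $\zeta\in\mathbb{C}\setminus\mathbb{R}$. Then the number of solutions $z\in\mathbb{C}\setminus\Gamma$, counted with multiplicity, of $G_\mu(z)=\zeta$ is bounded above by $$N=\frac12\,\sup_{y>0,\;y\notin S} C\bigl(\{x\in\mathbb{R}:\rho(x)=y\}\bigr).$$
   Context: $\Gamma$ denotes the support of $\mu$. The Stieltjes transform of $\mu$ is $G_\mu(z)=\int_\Gamma \frac{1}{z-x}\,\mathrm{d}\mu(x)$ for $z\in\mathbb{C}\setminus\Gamma$. For $A\subset\mathbb{R}$, $C(A)\in\mathbb{N}\cup\{\infty\}$ denotes the number of connected components of $A$, i.e. the number of equivalence classes of the relation on $A$ where $s\sim t$ iff the closed interval between $s$ and $t$ is contained in $A$ ($C(A)=\infty$ if there are infinitely many classes, countably or uncountably; $C(\emptyset)=0$). If $N=\infty$ the bound is vacuous. *)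

theory Defs
  imports "HOL-Complex_Analysis.Complex_Analysis"
begin

definition measure_support :: "real measure \<Rightarrow> real set" where
  "measure_support \<mu> = {x. \<forall>U. open U \<and> x \<in> U \<longrightarrow> emeasure \<mu> U > 0}"

definition stieltjes :: "real measure \<Rightarrow> complex \<Rightarrow> complex" where
  "stieltjes \<mu> z = (LINT x:measure_support \<mu>|\<mu>. 1 / (z - complex_of_real x))"

(* Borel representatives suffice: every Lebesgue measurable function agrees almost
   everywhere with a Borel measurable one. *)
definition in_Lp :: "real \<Rightarrow> (real \<Rightarrow> real) \<Rightarrow> bool" where
  "in_Lp p f \<longleftrightarrow> f \<in> borel_measurable lborel \<and> integrable lborel (\<lambda>x. \<bar>f x\<bar> powr p)"

definition test_function :: "(real \<Rightarrow> real) \<Rightarrow> bool" where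
  "test_function \<phi> \<longleftrightarrow>
     (\<forall>n. (deriv ^^ n) \<phi> differentiable_on UNIV) \<and> compact (closure {x. \<phi> x \<noteq> 0})"

definition weak_derivative :: "(real \<Rightarrow> real) \<Rightarrow> (real \<Rightarrow> real) \<Rightarrow> bool" where
  "weak_derivative f g \<longleftrightarrow>
     (\<forall>\<phi>. test_function \<phi> \<longrightarrow>
        (LINT x|lborel. f x * deriv \<phi> x) = - (LINT x|lborel. g x * \<phi> x))"

definition in_W1p :: "real \<Rightarrow> (real \<Rightarrow> real) \<Rightarrow> bool" where
  "in_W1p p f \<longleftrightarrow> in_Lp p f \<and> (\<exists>g. in_Lp p g \<and> weak_derivative f g)"

(* The members of D are non-overlapping compact intervals [Inf K, Sup K]. *)
definition abs_continuous_on_interval :: "real \<Rightarrow> real \<Rightarrow> (real \<Rightarrow> real) \<Rightarrow> bool" where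
  "abs_continuous_on_interval a b f \<longleftrightarrow>
     (\<forall>\<epsilon>>0. \<exists>\<delta>>0. \<forall>D. D division_of \<Union>D \<and> \<Union>D \<subseteq> {a..b} \<and> (\<Sum>K\<in>D. Sup K - Inf K) < \<delta>
        \<longrightarrow> (\<Sum>K\<in>D. \<bar>f (Sup K) - f (Inf K)\<bar>) < \<epsilon>)"

definition locally_abs_continuous :: "(real \<Rightarrow> real) \<Rightarrow> bool" where
  "locally_abs_continuous f \<longleftrightarrow> (\<forall>a b. abs_continuous_on_interval a b f)"

definition nowhere_dense :: "real set \<Rightarrow> bool" where
  "nowhere_dense S \<longleftrightarrow> interior (closure S) = {}"

definition num_components :: "real set \<Rightarrow> enat" where
  "num_components A = (if finite (components A) then enat (card (components A)) else \<infinity>)"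

lemma components_eq_quotient:
  fixes A :: "real set"
  shows "components A = A // {(s, t). s \<in> A \<and> t \<in> A \<and> closed_segment s t \<subseteq> A}"
proof -
  have *: "connected_component A s t \<longleftrightarrow> s \<in> A \<and> t \<in> A \<and> closed_segment s t \<subseteq> A" for s t
  proof
    assume "connected_component A s t"
    then obtain T where T: "connected T" "T \<subseteq> A" "s \<in> T" "t \<in> T"
      by (auto simp: connected_component_def)
    then have "closed_segment s t \<subseteq> T"
      by (meson closed_segment_subset is_interval_convex_1 is_interval_connected_1)
    with T show "s \<in> A \<and> t \<in> A \<and> closed_segment s t \<subseteq> A" by blast
  next
    assume "s \<in> A \<and> t \<in> A \<and> closed_segment s t \<subseteq> A"
    then show "connected_component A s t"
      unfolding connected_component_def
      by (intro exI[of _ "closed_segment s t"]) auto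
  qed
  have "connected_component_set A s = {(s, t). s \<in> A \<and> t \<in> A \<and> closed_segment s t \<subseteq> A} `` {s}" for s
    by (auto simp: *)
  then show ?thesis
    unfolding components_def quotient_def by blast
qed

(* Meaningful when F is holomorphic on the open set D and F - \<zeta> vanishes identically near
   no point of D: then zorder is the order of the zero, which is at least 1. *)
definition num_solutions :: "(complex \<Rightarrow> complex) \<Rightarrow> complex set \<Rightarrow> complex \<Rightarrow> enat" where
  "num_solutions F D \<zeta> =
     (let Z = {z \<in> D. F z = \<zeta>} in
      if finite Z then enat (\<Sum>z\<in>Z. nat (zorder (\<lambda>w. F w - \<zeta>) z)) else \<infinity>)"

end

theory Submission
  imports Defs
begin

text \<open>
  By conjugation symmetry let \<open>\<zeta>\<close> lie in the lower half-plane. All solutions then lie in the upper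
  half-plane, where \<open>G\<close> is the Cauchy transform of \<open>\<rho>\<close>. Suppose that \<open>G\<close> extends continuously to the
  real axis; its imaginary part there is \<open>-\<pi> \<rho>\<close>. By the argument principle the number of
  solutions is the winding number about \<open>\<zeta>\<close> of the closed curve traced by \<open>G\<close> along the real axis
  (closed up through infinity, where \<open>G\<close> vanishes). Between two consecutive half turns about \<open>\<zeta>\<close> the
  curve has to cross the horizontal line through \<open>\<zeta>\<close>, and it does so only over the level set of
  \<open>\<rho>\<close> at height \<open>y = - Im \<zeta> / \<pi>\<close>. So \<open>n\<close> turns require \<open>2 n\<close> points of this level set
  (\<open>winding_number_le_line_crossings\<close>).

  Two issues remain. The first is genericity: the level may lie in the exceptional set, its level set
  may contain intervals, and the curve may pass through \<open>\<zeta>\<close>. As the number of solutions away from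
  the boundary is stable under small changes of \<open>\<zeta>\<close>, both coordinates of \<open>\<zeta>\<close> can be moved
  slightly. The level is moved out of the nowhere dense set and away from the countably many
  levels whose level sets have interior (\<open>exists_generic_level\<close>); if a level set without
  interior has finitely many components, it is a finite set with one point per component
  (\<open>finite_components_empty_interior\<close>). The real part is then moved away from the finitely many
  values of \<open>G\<close> on this set. The count is carried out in
  \<open>zero_count_le_half_level_components\<close>.

  The second issue is the continuous extension. Let \<open>g\<close> be the weak derivative of \<open>\<rho>\<close>. Testing it
  against smooth approximations of indicator functions shows that \<open>\<rho>\<close> is a primitive of \<open>g\<close>
  (\<open>weak_derivative_FTC\<close>), and integration by parts turns the Cauchy transform into the
  logarithmic potential \<open>\<integral> g(t) log (z - t) dt\<close> (\<open>cauchy_transform_eq_log_potential\<close>). With a branch of the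
  logarithm that is continuous on the closed upper half-plane, this formula makes sense on the real
  axis as well. The potential is continuous up to the boundary because \<open>g\<close> is in \<open>L\<^sup>p\<close> and the
  logarithm is locally in every \<open>L\<^sup>q\<close> with \<open>q < \<infinity>\<close> (\<open>log_potential_continuous_integrable\<close>), and its
  imaginary part on the real axis can be read off from the jump of the argument
  (\<open>Im_log_potential_of_real\<close>).
\<close>

section \<open>Smooth step functions\<close>

text \<open>The functions \<open>P(1/x) exp (- 1/x)\<close> with a polynomial \<open>P\<close>, continued by zero. This family, unlike the
  single function with \<open>P = 1\<close>, is closed under differentiation.\<close>

definition flat :: "real poly \<Rightarrow> real \<Rightarrow> real" where
  "flat P x = (if x > 0 then poly P (1 / x) * exp (- (1 / x)) else 0)"

text \<open>Every function obtained by these rules is infinitely often differentiable, because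
  differentiating it stays inside the class. The class is closed under exactly the operations
  needed to build a smooth step; membership replaces any computation of higher derivatives.\<close>

inductive smooth :: "(real \<Rightarrow> real) \<Rightarrow> bool" where
  flat: "smooth (flat P)"
| affine: "smooth f \<Longrightarrow> smooth (\<lambda>x. f (c * x + d))"
| add: "smooth f \<Longrightarrow> smooth g \<Longrightarrow> smooth (\<lambda>x. f x + g x)"
| mult: "smooth f \<Longrightarrow> smooth g \<Longrightarrow> smooth (\<lambda>x. f x * g x)"
| antideriv: "smooth f \<Longrightarrow> (\<And>x. (F has_real_derivative f x) (at x)) \<Longrightarrow> smooth F"

lemma poly_exp_at_top: "((\<lambda>u::real. poly P u * exp (- u)) \<longlongrightarrow> 0) at_top"
proof -
  have "((\<lambda>u. \<Sum>i\<le>degree P. coeff P i * (u ^ i / exp u)) \<longlongrightarrow> (\<Sum>i\<le>degree P. coeff P i * 0)) at_top"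
    by (intro tendsto_sum tendsto_mult tendsto_const tendsto_power_div_exp_0)
  moreover have "(\<lambda>u. \<Sum>i\<le>degree P. coeff P i * (u ^ i / exp u)) = (\<lambda>u. poly P u * exp (- u))"
    by (simp add: poly_altdef exp_minus sum_distrib_right divide_inverse mult.assoc)
  ultimately show ?thesis by simp
qed

text \<open>At the origin the difference quotient from the right is a polynomial in \<open>1/x\<close> times
  \<open>exp (- 1/x)\<close>, and the exponential wins.\<close>

lemma flat_has_derivative:
  "(flat P has_real_derivative flat ([:0, 0, 1:] * (P - pderiv P)) x) (at x)"
proof -
  consider "x < 0" | "x = 0" | "x > 0" by linarith
  then show ?thesis
  proof cases
    case 1
    have "((\<lambda>_. 0) has_real_derivative 0) (at x)" by simp
    then have "(flat P has_real_derivative 0) (at x)"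
      by (rule has_field_derivative_transform_within_open[where S = "{..<0}"])
         (use 1 in \<open>auto simp: flat_def\<close>)
    then show ?thesis using 1 by (simp add: flat_def)
  next
    case 2
    have "((\<lambda>h. flat P h / h) \<longlongrightarrow> 0) (at_left 0)"
      by (rule tendsto_eventually) (auto simp: eventually_at_left_field flat_def intro: exI[of _ "-1"])
    moreover have "((\<lambda>h. flat P h / h) \<longlongrightarrow> 0) (at_right 0)"
    proof -
      have "((\<lambda>h::real. poly (pCons 0 P) (inverse h) * exp (- inverse h)) \<longlongrightarrow> 0) (at_right 0)"
        using filterlim_compose[OF poly_exp_at_top filterlim_inverse_at_top_right] .
      then show ?thesis
        by (rule Lim_transform_eventually)
           (auto simp: eventually_at_right_field flat_def field_simps intro!: exI[of _ 1])
    qed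
    ultimately have "((\<lambda>h. flat P h / h) \<longlongrightarrow> 0) (at 0)"
      by (simp add: filterlim_split_at)
    then show ?thesis using 2 by (simp add: has_field_derivative_iff flat_def)
  next
    case 3
    have "((\<lambda>x. poly P (1 / x) * exp (- (1 / x))) has_real_derivative
        flat ([:0, 0, 1:] * (P - pderiv P)) x) (at x)"
      using 3 by (auto intro!: derivative_eq_intros poly_DERIV[THEN DERIV_chain2]
          simp: flat_def power2_eq_square field_simps)
    then show ?thesis
      by (rule has_field_derivative_transform_within_open[where S = "{0<..}"])
         (use 3 in \<open>auto simp: flat_def\<close>)
  qed
qed

lemma smooth_const: "smooth (\<lambda>_. c)"
  by (rule smooth.antideriv[OF smooth.flat[of 0]]) (auto simp: flat_def)

lemma smooth_deriv:
  "smooth f \<Longrightarrow> \<exists>f'. smooth f' \<and> (\<forall>x. (f has_real_derivative f' x) (at x))"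
proof (induction rule: smooth.induct)
  case (flat P)
  show ?case
    by (intro exI[of _ "flat ([:0, 0, 1:] * (P - pderiv P))"] conjI allI smooth.flat flat_has_derivative)
next
  case (affine f c d)
  then obtain f' where f': "smooth f'" "\<And>x. (f has_real_derivative f' x) (at x)" by auto
  have "((\<lambda>x. f (c * x + d)) has_real_derivative (f' (c * x + d) * c)) (at x)" for x
    by (rule DERIV_chain2[OF f'(2)]) (auto intro!: derivative_eq_intros)
  moreover have "smooth (\<lambda>x. f' (c * x + d) * c)"
    by (rule smooth.mult[OF smooth.affine[OF f'(1)] smooth_const])
  ultimately show ?case by (intro exI[of _ "\<lambda>x. f' (c * x + d) * c"]) auto
next
  case (add f g)
  then obtain f' g' where "smooth f'" "\<And>x. (f has_real_derivative f' x) (at x)"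
    "smooth g'" "\<And>x. (g has_real_derivative g' x) (at x)" by auto
  then show ?case
    by (intro exI[of _ "\<lambda>x. f' x + g' x"] conjI allI smooth.add DERIV_add)
next
  case (mult f g)
  then obtain f' g' where "smooth f'" "\<And>x. (f has_real_derivative f' x) (at x)"
    "smooth g'" "\<And>x. (g has_real_derivative g' x) (at x)" by auto
  moreover from this have "smooth (\<lambda>x. f' x * g x + g' x * f x)"
    using mult by (intro smooth.add[OF smooth.mult smooth.mult]) auto
  ultimately show ?case
    by (intro exI[of _ "\<lambda>x. f' x * g x + g' x * f x"] conjI allI DERIV_mult)
next
  case (antideriv f F)
  then show ?case by blast
qed

lemma smooth_iterated_deriv: "smooth f \<Longrightarrow> smooth ((deriv ^^ n) f)"
proof (induction n)
  case (Suc n)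
  then obtain f' where "smooth f'" "\<And>x. ((deriv ^^ n) f has_real_derivative f' x) (at x)"
    using smooth_deriv by blast
  then have "deriv ((deriv ^^ n) f) = f'" by (intro ext DERIV_imp_deriv) auto
  then show ?case using \<open>smooth f'\<close> by simp
qed auto

lemma smooth_imp_continuous: "smooth f \<Longrightarrow> continuous_on UNIV f"
proof (rule continuous_at_imp_continuous_on, rule ballI)
  fix x assume "smooth f"
  then obtain f' where "(f has_real_derivative f' x) (at x)" using smooth_deriv by blast
  then show "isCont f x" by (rule DERIV_isCont)
qed

lemma test_functionI:
  assumes "smooth f" and "\<And>x. x \<notin> {a..b} \<Longrightarrow> f x = 0"
  shows "test_function f"
  unfolding test_function_def
proof
  show "\<forall>n. (deriv ^^ n) f differentiable_on UNIV"
    unfolding differentiable_on_def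
  proof (intro allI ballI)
    fix n x
    obtain f' where "((deriv ^^ n) f has_real_derivative f' x) (at x)"
      using smooth_deriv[OF smooth_iterated_deriv[OF assms(1)]] by blast
    then show "(deriv ^^ n) f differentiable at x within UNIV"
      using real_differentiable_def by blast
  qed
  have "{x. f x \<noteq> 0} \<subseteq> {a..b}" using assms(2) by blast
  then show "compact (closure {x. f x \<noteq> 0})"
    by (meson bounded_closed_interval bounded_subset compact_closure)
qed

definition bump :: "real \<Rightarrow> real" where
  "bump x = flat 1 x * flat 1 (1 - x)"

lemma smooth_bump: "smooth bump"
proof -
  have "smooth (\<lambda>x. flat 1 x * flat 1 (- 1 * x + 1))"
    by (rule smooth.mult[OF smooth.flat smooth.affine[OF smooth.flat]])
  then show ?thesis by (simp add: bump_def[abs_def])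
qed

lemma bump_nonneg: "0 \<le> bump x" and bump_eq_0: "x \<notin> {0<..<1} \<Longrightarrow> bump x = 0"
  and bump_pos: "x \<in> {0<..<1} \<Longrightarrow> 0 < bump x"
  by (auto simp: bump_def flat_def)

text \<open>A primitive of the bump: a smooth function that climbs from \<open>0\<close> to \<open>c\<close> on the unit interval
  and is constant on both sides of it.\<close>

lemma obtain_smooth_step:
  obtains B c where "c > 0" "\<And>x. (B has_real_derivative bump x) (at x)"
    "\<And>x. x \<le> 0 \<Longrightarrow> B x = 0" "\<And>x. x \<ge> 1 \<Longrightarrow> B x = c"
    "\<And>x. 0 \<le> B x" "\<And>x. B x \<le> c"
proof -
  define B where "B x = (LBINT y=0..x. bump y)" for x :: real
  have cont: "continuous_on A bump" for A
    using smooth_imp_continuous[OF smooth_bump] continuous_on_subset by blast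
  have der: "(B has_real_derivative bump x) (at x)" for x
  proof -
    define l where "l = \<bar>x\<bar> + 1"
    have "((\<lambda>u. LBINT y=ereal 0..ereal u. bump y) has_vector_derivative (bump x)) (at x within {-l..l})"
      by (rule interval_integral_FTC2) (auto simp: l_def cont)
    moreover have "at x within {-l..l} = at x"
      by (rule at_within_interior) (auto simp: l_def)
    ultimately show ?thesis
      by (simp add: B_def[abs_def] has_real_derivative_iff_has_vector_derivative zero_ereal_def)
  qed
  have contB: "continuous_on A B" for A
    by (intro continuous_at_imp_continuous_on ballI DERIV_isCont[OF der])
  have mono: "B x \<le> B y" if "x \<le> y" for x y
    by (rule DERIV_nonneg_imp_nondecreasing[OF that]) (use der bump_nonneg in blast)
  have zero: "B 0 = 0" by (simp add: B_def zero_ereal_def)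
  have const: "B x = B y" if "x < y" "{x<..<y} \<inter> {0<..<1} = {}" for x y
  proof (rule DERIV_isconst_end[OF that(1), symmetric])
    show "continuous_on {x..y} B" by (rule contB)
    fix z assume "x < z" "z < y"
    then have "bump z = 0" using that(2) by (intro bump_eq_0) auto
    then show "(B has_real_derivative 0) (at z)" using der[of z] by simp
  qed
  have lo: "B x = 0" if "x \<le> 0" for x
    using const[of x 0] zero that by (cases "x = 0") auto
  have hi: "B x = B 1" if "x \<ge> 1" for x
    using const[of 1 x] that by (cases "x = 1") auto
  have pos: "B 1 > 0"
  proof -
    have "B 0 < B 1"
    proof (rule DERIV_pos_imp_increasing_open[of 0 1])
      show "\<exists>y. (B has_real_derivative y) (at x) \<and> y > 0" if "0 < x" "x < 1" for x
        using der[of x] bump_pos[of x] that by auto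
      show "continuous_on {0..1} B" by (rule contB)
    qed auto
    then show ?thesis using zero by simp
  qed
  show thesis
  proof (rule that[OF pos der lo hi])
    show "0 \<le> B x" for x using mono[of "min x 0" x] lo[of "min x 0"] by simp
    show "B x \<le> B 1" for x using mono[of x "max x 1"] hi[of "max x 1"] by simp
  qed auto
qed

section \<open>Primitives from weak derivatives\<close>

lemma integrable_compactly_supported:
  fixes f :: "real \<Rightarrow> 'a::{banach, second_countable_topology}"
  assumes "continuous_on UNIV f" and "\<And>x. x \<notin> {a..b} \<Longrightarrow> f x = 0"
  shows "integrable lborel f"
proof -
  have "integrable lborel (\<lambda>x. indicator {a..b} x *\<^sub>R f x)"
    by (intro borel_integrable_compact compact_Icc continuous_on_subset[OF assms(1)]) auto
  moreover have "(\<lambda>x. indicator {a..b} x *\<^sub>R f x) = f"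
    using assms(2) by (force simp: indicator_def)
  ultimately show ?thesis by simp
qed

lemma in_Lp_imp_set_integrable:
  assumes "in_Lp p g" and "1 < p"
  shows "set_integrable lborel {a..b} g"
  unfolding set_integrable_def
proof (rule Bochner_Integration.integrable_bound)
  have [measurable]: "g \<in> borel_measurable lborel" using assms by (simp add: in_Lp_def)
  show "integrable lborel (\<lambda>x. indicator {a..b} x + \<bar>g x\<bar> powr p)"
    using assms by (intro Bochner_Integration.integrable_add integrable_real_indicator)
      (auto simp: in_Lp_def emeasure_lborel_Icc_eq)
  show "(\<lambda>x. indicator {a..b} x *\<^sub>R g x) \<in> borel_measurable lborel" by measurable
  have "\<bar>g x\<bar> \<le> 1 + \<bar>g x\<bar> powr p" for x
  proof (cases "\<bar>g x\<bar> \<le> 1")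
    case False
    then have "\<bar>g x\<bar> powr 1 \<le> \<bar>g x\<bar> powr p" using assms(2) by (intro powr_mono) auto
    then show ?thesis using False by simp
  qed (use powr_ge_zero[of "\<bar>g x\<bar>" p] in linarith)
  then show "AE x in lborel. norm (indicator {a..b} x *\<^sub>R g x) \<le> norm (indicator {a..b} x + \<bar>g x\<bar> powr p)"
    by (intro AE_I2) (simp add: indicator_def)
qed

lemma locally_abs_continuous_imp_continuous:
  assumes "locally_abs_continuous f"
  shows "continuous_on UNIV f"
proof (rule continuous_at_imp_continuous_on, rule ballI)
  fix x
  show "isCont f x"
    unfolding continuous_at_real_range real_norm_def
  proof (intro allI impI)
    fix e :: real assume "e > 0"
    define P where "P d \<longleftrightarrow> (\<forall>D. D division_of \<Union>D \<and> \<Union>D \<subseteq> {x - 1..x + 1} \<and>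
        (\<Sum>K\<in>D. Sup K - Inf K) < d \<longrightarrow> (\<Sum>K\<in>D. \<bar>f (Sup K) - f (Inf K)\<bar>) < e)" for d
    have "\<exists>d>0. P d"
      using assms \<open>e > 0\<close>
      unfolding locally_abs_continuous_def abs_continuous_on_interval_def P_def by presburger
    then obtain d where "d > 0" and d: "P d" by blast
    have *: "\<bar>f v - f u\<bar> < e" if "u \<le> v" "{u..v} \<subseteq> {x - 1..x + 1}" "v - u < d" for u v
    proof -
      have "{{u..v}} division_of {u..v}"
        using division_of_self[of u v] that(1) by (simp add: cbox_interval)
      then show ?thesis using d[unfolded P_def, rule_format, of "{{u..v}}"] that by simp
    qed
    have "\<bar>f y - f x\<bar> < e" if "\<bar>y - x\<bar> < min d 1" for y
    proof (cases "x \<le> y")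
      case True
      then show ?thesis using *[of x y] that by auto
    next
      case False
      then have "\<bar>f x - f y\<bar> < e" using *[of y x] that by auto
      then show ?thesis by linarith
    qed
    then show "\<exists>d>0. \<forall>y. \<bar>y - x\<bar> < d \<longrightarrow> \<bar>f y - f x\<bar> < e"
      using \<open>d > 0\<close> by (intro exI[of _ "min d 1"]) auto
  qed
qed

text \<open>The scaled bumps concentrate at \<open>a\<close>: after the substitution \<open>x = a + s / (n + 1)\<close> the scale sits
  in the argument of \<open>f\<close> only, where continuity takes over.\<close>

lemma integral_scaled_bump_tendsto:
  assumes cont: "continuous_on UNIV f" and bnd: "\<And>x. \<bar>f x\<bar> \<le> C"
  shows "(\<lambda>n. LINT x|lborel. f x * (Suc n * bump (Suc n * (x - a))))
           \<longlonglongrightarrow> f a * (LINT x|lborel. bump x)"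
proof -
  have contb: "continuous_on A bump" for A
    using smooth_imp_continuous[OF smooth_bump] continuous_on_subset by blast
  have intb: "integrable lborel bump"
    by (rule integrable_compactly_supported[of _ 0 1]) (auto simp: contb intro!: bump_eq_0)
  have [measurable]: "f \<in> borel_measurable borel" "bump \<in> borel_measurable borel"
    using cont contb by (auto intro: borel_measurable_continuous_onI)
  have "(LINT x|lborel. f x * (Suc n * bump (Suc n * (x - a))))
      = (LINT s|lborel. f (a + inverse (Suc n) * s) * bump s)" for n
  proof -
    have "(LINT x|lborel. f x * (Suc n * bump (Suc n * (x - a))))
        = inverse (Suc n) * (LINT s|lborel. f (a + inverse (Suc n) * s) *
            (Suc n * bump (Suc n * (a + inverse (Suc n) * s - a))))"
      by (subst lborel_integral_real_affine[where t = a and c = "inverse (Suc n)"]) auto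
    also have "(\<lambda>s. f (a + inverse (Suc n) * s) * (Suc n * bump (Suc n * (a + inverse (Suc n) * s - a))))
        = (\<lambda>s. Suc n * (f (a + inverse (Suc n) * s) * bump s))"
      by (intro ext) (simp del: of_nat_Suc flip: mult.assoc)
    finally show ?thesis by (simp del: of_nat_Suc)
  qed
  moreover have "(\<lambda>n. LINT s|lborel. f (a + inverse (Suc n) * s) * bump s)
      \<longlonglongrightarrow> (LINT s|lborel. f a * bump s)"
  proof (rule integral_dominated_convergence)
    show "integrable lborel (\<lambda>s. C * bump s)" using intb by simp
    show "AE s in lborel. (\<lambda>n. f (a + inverse (Suc n) * s) * bump s) \<longlonglongrightarrow> f a * bump s"
    proof (intro AE_I2 tendsto_mult tendsto_const)
      fix s
      have "(\<lambda>n. a + inverse (Suc n) * s) \<longlonglongrightarrow> a + 0 * s"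
        by (intro tendsto_intros LIMSEQ_inverse_real_of_nat)
      then show "(\<lambda>n. f (a + inverse (Suc n) * s)) \<longlonglongrightarrow> f a"
        using cont by (intro continuous_on_tendsto_compose[OF cont]) auto
    qed
    show "AE s in lborel. norm (f (a + inverse (Suc n) * s) * bump s) \<le> C * bump s" for n
      using bnd by (auto simp: abs_mult bump_nonneg intro!: mult_right_mono)
  qed simp_all
  ultimately show ?thesis by simp
qed

text \<open>The definition of the weak derivative is applied to differences of two smooth steps that climb to the same height \<open>c\<close>, one just to the right of
  \<open>a\<close> and one just to the right of \<open>b\<close>. They tend to \<open>c\<close> times the indicator of the interval, while their
  derivatives are two scaled bumps that recover the values of \<open>f\<close> at the end points.\<close>

lemma weak_derivative_FTC:
  assumes weak: "weak_derivative f g" and cont: "continuous_on UNIV f"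
    and bnd: "\<And>x. \<bar>f x\<bar> \<le> C" and g: "\<And>a b. set_integrable lborel {a..b} g"
    and gm: "g \<in> borel_measurable lborel"
    and "a \<le> b"
  shows "(LINT x:{a..b}|lborel. g x) = f b - f a"
proof -
  obtain B c where c: "c > 0" and B: "\<And>x. (B has_real_derivative bump x) (at x)"
    "\<And>x. x \<le> 0 \<Longrightarrow> B x = 0" "\<And>x. x \<ge> 1 \<Longrightarrow> B x = c" "\<And>x. 0 \<le> B x" "\<And>x. B x \<le> c"
    by (rule obtain_smooth_step, rule that, assumption+)
  note [measurable] = gm
  have contb: "continuous_on A bump" for A
    using smooth_imp_continuous[OF smooth_bump] continuous_on_subset by blast
  have "smooth B" by (rule smooth.antideriv[OF smooth_bump B(1)])
  have Bm[measurable]: "B \<in> borel_measurable borel"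
    by (intro borel_measurable_continuous_onI smooth_imp_continuous \<open>smooth B\<close>)
  have c_eq: "(LINT x|lborel. bump x) = c"
  proof -
    have "(LINT x|lborel. bump x * indicator {0..1} x) = B 1 - B 0"
      by (rule integral_FTC_Icc_real) (use B(1) contb[of UNIV] in \<open>auto simp: continuous_on_eq_continuous_at\<close>)
    moreover have "(\<lambda>x. bump x * indicator {0..1} x) = bump"
    proof
      fix x show "bump x * indicator {0..1} x = bump x"
        by (cases "x \<in> {0<..<1}") (auto simp: bump_eq_0)
    qed
    ultimately show ?thesis using B(2)[of 0] B(3)[of 1] by simp
  qed
  define \<phi> where "\<phi> n x = B (Suc n * (x - a)) - B (Suc n * (x - b))" for n and x :: real
  have \<phi>_outside: "\<phi> n x = 0" if "x \<notin> {a..b + 1}" for n x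
  proof (cases "x < a")
    case True
    then show ?thesis using \<open>a \<le> b\<close> B(2) by (simp add: \<phi>_def mult_nonneg_nonpos)
  next
    case False
    then have "1 \<le> x - b" using that by auto
    then have "1 \<le> real (Suc n) * (x - b)" "1 \<le> real (Suc n) * (x - a)"
      using \<open>a \<le> b\<close> mult_mono[of 1 "real (Suc n)" 1] by auto
    then show ?thesis using B(3) by (simp add: \<phi>_def)
  qed
  have test: "test_function (\<phi> n)" for n
  proof (rule test_functionI[where a = a and b = "b + 1"])
    have "smooth (\<lambda>x. B (Suc n * x + (- Suc n * a)) + (\<lambda>_. -1) x * B (Suc n * x + (- Suc n * b)))"
      by (intro smooth.add[OF smooth.affine smooth.mult[OF smooth_const smooth.affine]] \<open>smooth B\<close>)
    then show "smooth (\<phi> n)" by (simp add: \<phi>_def[abs_def] algebra_simps)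
  qed (rule \<phi>_outside)
  have deriv: "deriv (\<phi> n) x = Suc n * bump (Suc n * (x - a)) - Suc n * bump (Suc n * (x - b))" for n x
    unfolding \<phi>_def
    by (intro DERIV_imp_deriv) (auto intro!: derivative_eq_intros B(1)[THEN DERIV_chain2])
  have int: "integrable lborel (\<lambda>x. f x * (Suc n * bump (Suc n * (x - u))))" for n u
  proof (rule integrable_compactly_supported[of _ u "u + 1"])
    show "continuous_on UNIV (\<lambda>x. f x * (Suc n * bump (Suc n * (x - u))))"
      by (intro continuous_intros cont continuous_on_compose2[OF contb[of UNIV]]) auto
    have "real (Suc n) * (x - u) \<notin> {0<..<1}" if "x \<notin> {u..u + 1}" for x
      using that mult_mono[of 1 "real (Suc n)" 1 "x - u"] by (auto simp: zero_less_mult_iff)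
    then show "f x * (Suc n * bump (Suc n * (x - u))) = 0" if "x \<notin> {u..u + 1}" for x
      using bump_eq_0 that by simp
  qed
  have "(\<lambda>n. (LINT x|lborel. f x * (Suc n * bump (Suc n * (x - a))))
           - (LINT x|lborel. f x * (Suc n * bump (Suc n * (x - b))))) \<longlonglongrightarrow> f a * c - f b * c"
    unfolding c_eq[symmetric] by (intro tendsto_diff integral_scaled_bump_tendsto[OF cont bnd])
  also have "(\<lambda>n. (LINT x|lborel. f x * (Suc n * bump (Suc n * (x - a))))
           - (LINT x|lborel. f x * (Suc n * bump (Suc n * (x - b))))) = (\<lambda>n. LINT x|lborel. f x * deriv (\<phi> n) x)"
    by (subst Bochner_Integration.integral_diff[symmetric, OF int int]) (simp add: deriv right_diff_distrib)
  also have "\<dots> = (\<lambda>n. - (LINT x|lborel. g x * \<phi> n x))"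
    using weak test by (simp add: weak_derivative_def)
  finally have 1: "(\<lambda>n. - (LINT x|lborel. g x * \<phi> n x)) \<longlonglongrightarrow> f a * c - f b * c" .
  have 2: "(\<lambda>n. LINT x|lborel. g x * \<phi> n x) \<longlonglongrightarrow> (LINT x|lborel. c * (indicator {a..b} x * g x))"
  proof (rule integral_dominated_convergence)
    show "integrable lborel (\<lambda>x. c * (indicator {a..b + 1} x * \<bar>g x\<bar>))"
      using set_integrable_abs[OF g[of a "b + 1"]] by (simp add: set_integrable_def)
    show "AE x in lborel. norm (g x * \<phi> n x) \<le> c * (indicator {a..b + 1} x * \<bar>g x\<bar>)" for n
    proof (rule AE_I2)
      fix x
      have "\<bar>\<phi> n x\<bar> \<le> c" unfolding \<phi>_def
        using B(4)[of "Suc n * (x - a)"] B(5)[of "Suc n * (x - a)"]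
          B(4)[of "Suc n * (x - b)"] B(5)[of "Suc n * (x - b)"] by linarith
      then show "norm (g x * \<phi> n x) \<le> c * (indicator {a..b + 1} x * \<bar>g x\<bar>)"
        using \<phi>_outside[of x n]
        by (auto simp: indicator_def abs_mult mult.commute[of c] mult_left_mono)
    qed
    have lim: "(\<lambda>n. B (Suc n * (x - u))) \<longlonglongrightarrow> (if x > u then c else 0)" for x u :: real
    proof (cases "x > u")
      case True
      have "filterlim (\<lambda>n. real (Suc n) * (x - u)) at_top sequentially"
        using True by (intro filterlim_at_top_mult_tendsto_pos[OF tendsto_const]
          filterlim_compose[OF filterlim_real_sequentially filterlim_Suc]) auto
      then have "eventually (\<lambda>n. 1 \<le> real (Suc n) * (x - u)) sequentially"
        by (simp add: filterlim_at_top)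
      then have "eventually (\<lambda>n. B (Suc n * (x - u)) = c) sequentially"
        by eventually_elim (rule B(3))
      then show ?thesis using True by (simp add: tendsto_eventually)
    qed (use B(2) in \<open>simp add: mult_nonneg_nonpos\<close>)
    have *: "(\<lambda>n. g x * \<phi> n x) \<longlonglongrightarrow> c * (indicator {a..b} x * g x)" if "x \<noteq> a" for x
    proof -
      have "(\<lambda>n. g x * \<phi> n x) \<longlonglongrightarrow> g x * ((if x > a then c else 0) - (if x > b then c else 0))"
        unfolding \<phi>_def by (intro tendsto_intros lim)
      moreover have "g x * ((if x > a then c else 0) - (if x > b then c else 0))
          = c * (indicator {a..b} x * g x)"
        using that \<open>a \<le> b\<close> by (auto simp: indicator_def)
      ultimately show ?thesis by simp
    qed
    \<comment> \<open>at \<open>a\<close> itself all \<open>\<phi> n\<close> vanish, unlike the indicator of the closed interval\<close>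
    show "AE x in lborel. (\<lambda>n. g x * \<phi> n x) \<longlonglongrightarrow> c * (indicator {a..b} x * g x)"
      using AE_lborel_singleton[of a] by eventually_elim (rule *)
  qed (simp_all add: \<phi>_def)
  have "- (c * (LINT x:{a..b}|lborel. g x)) = f a * c - f b * c"
    using LIMSEQ_unique[OF tendsto_minus[OF 2] 1] by (simp add: set_lebesgue_integral_def)
  then have "c * (LINT x:{a..b}|lborel. g x) = c * (f b - f a)" by (simp add: algebra_simps)
  then show ?thesis using c by simp
qed

section \<open>Logarithmic potentials up to the boundary\<close>

text \<open>A branch of the logarithm that is continuous on the closed upper half-plane without the origin:
  the rotation moves the cut of the principal branch to the negative imaginary axis. In
  the open half-plane it differs from the principal branch by a constant, which disappears on
  integration against a function of mean zero.\<close>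

definition log_kernel :: "complex \<Rightarrow> complex" where
  "log_kernel w = Ln (- \<i> * w)"

definition log_potential :: "(real \<Rightarrow> real) \<Rightarrow> real \<Rightarrow> complex \<Rightarrow> complex" where
  "log_potential g M z = (LINT t:{-M..M}|lborel. g t *\<^sub>R log_kernel (z - of_real t))"

lemma upper_rotated_notin_nonpos:
  assumes "Im w \<ge> 0" "w \<noteq> 0"
  shows "- \<i> * w \<notin> \<real>\<^sub>\<le>\<^sub>0"
  using assms by (auto simp: complex_nonpos_Reals_iff complex_eq_iff)

lemma isCont_log_kernel:
  assumes "Im w \<ge> 0" "w \<noteq> 0"
  shows "isCont log_kernel w"
  unfolding log_kernel_def[abs_def]
  by (intro isCont_Ln' continuous_intros upper_rotated_notin_nonpos assms)

lemma log_kernel_measurable [measurable]: "log_kernel \<in> borel_measurable borel"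
  unfolding log_kernel_def[abs_def] by measurable

lemma norm_log_kernel_sub_le:
  assumes "w \<noteq> 0"
  shows "norm (log_kernel w - of_real c) \<le> \<bar>ln (norm w) - c\<bar> + pi"
proof -
  have "norm (log_kernel w - of_real c) \<le> \<bar>Re (log_kernel w - of_real c)\<bar> + \<bar>Im (log_kernel w - of_real c)\<bar>"
    by (rule cmod_le)
  also have "Re (log_kernel w - of_real c) = ln (norm w) - c"
    using assms by (simp add: log_kernel_def norm_mult)
  also have "\<bar>Im (log_kernel w - of_real c)\<bar> \<le> pi"
    using assms mpi_less_Im_Ln[of "- \<i> * w"] Im_Ln_le_pi[of "- \<i> * w"] by (simp add: log_kernel_def)
  finally show ?thesis by simp
qed

text \<open>An integrable function that dominates the logarithmic singularity after Young's
  inequality.\<close>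

definition inv_sqrt_on :: "real \<Rightarrow> real \<Rightarrow> real" where
  "inv_sqrt_on L s = indicator {-L..L} s * \<bar>s\<bar> powr (- (1 / 2))"

lemma integrable_inv_sqrt_on:
  assumes "L \<ge> 0"
  shows "integrable lborel (inv_sqrt_on L)"
proof -
  define h where "h s = indicator {0..L} s * s powr (- (1 / 2))" for s :: real
  have h: "integrable lborel h"
  proof (rule integrableI_nonneg)
    have "((\<lambda>x. x powr (- (1 / 2))) has_integral (L powr (- (1 / 2) + 1) / (- (1 / 2) + 1))) {0..L}"
      using assms by (intro has_integral_powr_from_0) auto
    then have "(h has_integral (L powr (- (1 / 2) + 1) / (- (1 / 2) + 1))) UNIV"
      unfolding h_def[abs_def] by (subst (asm) has_integral_restrict_UNIV[symmetric])
        (simp add: indicator_def of_bool_def if_distrib[of "\<lambda>u. u * _"] cong: if_cong)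
    then have "integral\<^sup>N lborel h = ennreal (L powr (- (1 / 2) + 1) / (- (1 / 2) + 1))"
      by (intro nn_integral_has_integral_lborel) (auto simp: h_def[abs_def])
    then show "integral\<^sup>N lborel h < \<infinity>" by simp
  qed (auto simp: h_def[abs_def])
  have "integrable lborel (\<lambda>s. h s + h (0 + (-1) * s))"
    by (intro Bochner_Integration.integrable_add h lborel_integrable_real_affine) auto
  moreover have "(\<lambda>s. h s + h (0 + (-1) * s)) = inv_sqrt_on L"
    by (intro ext) (auto simp: h_def inv_sqrt_on_def indicator_def)
  ultimately show ?thesis by simp
qed

text \<open>A crude form of Young's inequality: whichever of the two factors is larger (after taking
  suitable powers), one of the summands alone dominates the product. The exponent is half the
  reciprocal of the exponent conjugate to \<open>p\<close>, so that the second summand is integrable at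
  \<open>0\<close>.\<close>

lemma mult_powr_le:
  fixes a p s :: real
  assumes "1 < p" "0 \<le> a" "0 < s"
  shows "a * s powr (- ((p - 1) / (2 * p))) \<le> a powr p + s powr (- (1 / 2))"
proof (cases "a \<le> s powr (- (1 / (2 * p)))")
  case True
  then have "a * s powr (- ((p - 1) / (2 * p))) \<le> s powr (- (1 / (2 * p))) * s powr (- ((p - 1) / (2 * p)))"
    by (intro mult_right_mono) auto
  also have "\<dots> = s powr (- (1 / 2))"
    using assms by (subst powr_add[symmetric]) (auto simp: field_simps)
  finally show ?thesis using powr_ge_zero[of a p] by linarith
next
  case False
  then have "(s powr (- (1 / (2 * p)))) powr (p - 1) \<le> a powr (p - 1)"
    using assms by (intro powr_mono2) auto
  also have "(s powr (- (1 / (2 * p)))) powr (p - 1) = s powr (- ((p - 1) / (2 * p)))"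
    by (simp add: powr_powr)
  finally have "a * s powr (- ((p - 1) / (2 * p))) \<le> a * a powr (p - 1)"
    using assms by (intro mult_left_mono) auto
  also have "\<dots> = a powr p"
  proof -
    have "a > 0" using False powr_ge_zero[of s "- (1 / (2 * p))"] assms by linarith
    then show ?thesis by (simp add: powr_diff)
  qed
  finally show ?thesis using powr_ge_zero[of s "- (1 / 2)"] by linarith
qed

text \<open>The density is only in \<open>L\<^sup>p\<close> and the singularity of the kernel moves with \<open>z\<close>, so dominated
  convergence does not apply directly. It does apply to the kernels whose real part is cut off at
  \<open>-n\<close>. The error of the cut-off is at most \<open>exp (- \<beta> n) \<bar>x - t\<bar> powr (- \<beta>) / \<beta>\<close> with \<open>x = Re z\<close>, and by
  Young's inequality its integral against \<open>g\<close> is bounded independently of \<open>z\<close>; hence the cut-off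
  potentials converge uniformly. The exponent \<open>\<beta>\<close> is positive because
  \<open>p > 1\<close>.\<close>

lemma log_potential_continuous_integrable:
  assumes p: "1 < p" and g: "in_Lp p g" and M: "M \<ge> 0" and r: "r \<ge> 0"
  shows "continuous_on (cball 0 r \<inter> {z. Im z \<ge> 0}) (log_potential g M)" (is "continuous_on ?A _")
    and "\<And>z. norm z \<le> r \<Longrightarrow> Im z \<ge> 0 \<Longrightarrow>
      set_integrable lborel {-M..M} (\<lambda>t. g t *\<^sub>R log_kernel (z - of_real t))"
proof -
  have gm [measurable]: "g \<in> borel_measurable borel" and gp: "integrable lborel (\<lambda>x. \<bar>g x\<bar> powr p)"
    using g by (auto simp: in_Lp_def)
  have gi: "set_integrable lborel {-M..M} g" using in_Lp_imp_set_integrable[OF g p] .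
  define \<beta> where "\<beta> = (p - 1) / (2 * p)"
  have "\<beta> > 0" using p by (simp add: \<beta>_def)
  define excess where "excess n w = min 0 (ln (cmod w) + real n)" for n w
  define F where "F n z = (LINT t:{-M..M}|lborel. g t *\<^sub>R
     (log_kernel (z - of_real t) - of_real (excess n (z - of_real t))))" for n z
  define L where "L = r + M"
  have [measurable]: "excess n \<in> borel_measurable borel" for n
    unfolding excess_def[abs_def] by measurable
  have norm_le: "norm (z - of_real t) \<le> L" if "z \<in> ?A" "t \<in> {-M..M}" for z t
    using that norm_triangle_ineq4[of z "of_real t"] by (auto simp: L_def)
  have bound: "norm (log_kernel w - of_real (excess n w)) \<le> real n + \<bar>ln (L + 1)\<bar> + pi"
    if "norm w \<le> L" "w \<noteq> 0" for w n
  proof -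
    have "ln (norm w) \<le> ln (L + 1)" using that by (intro ln_mono) auto
    then have "\<bar>ln (norm w) - excess n w\<bar> \<le> real n + \<bar>ln (L + 1)\<bar>"
      by (auto simp: excess_def min_def)
    then show ?thesis using norm_log_kernel_sub_le[OF that(2), of "excess n w"] by linarith
  qed
  have dominated: "AE t in lborel. norm (indicator {-M..M} t *\<^sub>R g t *\<^sub>R
      (log_kernel (z - of_real t) - of_real (excess n (z - of_real t))))
    \<le> (real n + \<bar>ln (L + 1)\<bar> + pi) * \<bar>indicator {-M..M} t *\<^sub>R g t\<bar>" if "z \<in> ?A" for z n
    using AE_lborel_singleton[of "Re z"]
  proof eventually_elim
    case (elim t)
    then have "z - of_real t \<noteq> 0" by (auto simp: complex_eq_iff)
    then show ?case
      using bound[OF norm_le[OF that], of t n]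
      by (auto simp: indicator_def abs_mult mult.commute intro!: mult_left_mono)
  qed
  have int_F: "set_integrable lborel {-M..M} (\<lambda>t. g t *\<^sub>R
     (log_kernel (z - of_real t) - of_real (excess n (z - of_real t))))" if "z \<in> ?A" for z n
    unfolding set_integrable_def
  proof (rule Bochner_Integration.integrable_bound)
    show "integrable lborel (\<lambda>t. (real n + \<bar>ln (L + 1)\<bar> + pi) * (indicator {-M..M} t *\<^sub>R g t))"
      using gi by (intro integrable_mult_right) (simp add: set_integrable_def)
    show "AE t in lborel. norm (indicator {-M..M} t *\<^sub>R g t *\<^sub>R
        (log_kernel (z - of_real t) - of_real (excess n (z - of_real t))))
      \<le> norm ((real n + \<bar>ln (L + 1)\<bar> + pi) * (indicator {-M..M} t *\<^sub>R g t))"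
      using dominated[OF that, of n] by (simp add: abs_mult)
  qed simp
  have cont_F: "continuous_on ?A (F n)" for n
    unfolding continuous_on_sequentially
  proof (intro allI ballI impI)
    fix u z assume z: "z \<in> ?A" and u: "(\<forall>k. u k \<in> ?A) \<and> u \<longlonglongrightarrow> z"
    show "(F n \<circ> u) \<longlonglongrightarrow> F n z"
      unfolding o_def F_def set_lebesgue_integral_def
    proof (rule integral_dominated_convergence)
      show "integrable lborel (\<lambda>t. (real n + \<bar>ln (L + 1)\<bar> + pi) * \<bar>indicator {-M..M} t *\<^sub>R g t\<bar>)"
        using gi by (intro integrable_mult_right integrable_abs) (simp add: set_integrable_def)
      show "AE t in lborel. norm (indicator {-M..M} t *\<^sub>R g t *\<^sub>R
          (log_kernel (u k - of_real t) - of_real (excess n (u k - of_real t))))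
        \<le> (real n + \<bar>ln (L + 1)\<bar> + pi) * \<bar>indicator {-M..M} t *\<^sub>R g t\<bar>" for k
        using dominated u by blast
      have lim: "(\<lambda>k. log_kernel (u k - of_real t) - of_real (excess n (u k - of_real t)))
           \<longlonglongrightarrow> log_kernel (z - of_real t) - of_real (excess n (z - of_real t))"
        if "t \<noteq> Re z" for t
      proof -
        have w: "z - of_real t \<noteq> 0" "Im (z - of_real t) \<ge> 0" using that z by (auto simp: complex_eq_iff)
        have lim: "(\<lambda>k. u k - of_real t) \<longlonglongrightarrow> z - of_real t" using u by (intro tendsto_intros) auto
        show ?thesis
          unfolding excess_def using w
          by (intro tendsto_intros isCont_tendsto_compose[OF isCont_log_kernel lim] lim) auto
      qed
      show "AE t in lborel. (\<lambda>k. indicator {-M..M} t *\<^sub>R g t *\<^sub>R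
          (log_kernel (u k - of_real t) - of_real (excess n (u k - of_real t))))
        \<longlonglongrightarrow> indicator {-M..M} t *\<^sub>R g t *\<^sub>R (log_kernel (z - of_real t) - of_real (excess n (z - of_real t)))"
        using AE_lborel_singleton[of "Re z"] by eventually_elim (intro tendsto_scaleR tendsto_const lim)
    qed simp_all
  qed
  define C where "C = (LINT t|lborel. \<bar>g t\<bar> powr p) + (LINT s|lborel. inv_sqrt_on L s)"
  have split: "g t *\<^sub>R log_kernel w = g t *\<^sub>R (log_kernel w - of_real (excess n w)) + g t *\<^sub>R complex_of_real (excess n w)"
    for t n w
    by (simp flip: scaleR_add_right)
  have diff: "set_integrable lborel {-M..M} (\<lambda>t. g t *\<^sub>R log_kernel (z - of_real t)) \<and>
    norm (F n z - log_potential g M z) \<le> exp (- (\<beta> * n)) / \<beta> * C" if z: "z \<in> ?A" for n z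
  proof -
    define x where "x = Re z"
    have x: "\<bar>x\<bar> \<le> r" using z abs_Re_le_cmod[of z] by (auto simp: x_def)
    define dom where "dom t = exp (- (\<beta> * n)) / \<beta> * (\<bar>g t\<bar> powr p + inv_sqrt_on L (x + (-1) * t))" for t
    have dom_int: "integrable lborel dom"
      unfolding dom_def[abs_def] using r M
      by (intro integrable_mult_right Bochner_Integration.integrable_add gp
            lborel_integrable_real_affine integrable_inv_sqrt_on) (auto simp: L_def)
    have le: "norm (indicator {-M..M} t *\<^sub>R g t *\<^sub>R complex_of_real (excess n (z - of_real t))) \<le> dom t"
      if "t \<noteq> x" for t
    proof (cases "t \<in> {-M..M}")
      case True
      define s where "s = \<bar>x - t\<bar>"
      have s: "0 < s" "s \<le> L" using that True x by (auto simp: s_def L_def)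
      have "s \<le> norm (z - of_real t)"
        using abs_Re_le_cmod[of "z - of_real t"] by (simp add: s_def x_def)
      then have "ln s \<le> ln (norm (z - of_real t))" using s by (intro ln_mono) auto
      then have "\<bar>excess n (z - of_real t)\<bar> \<le> max 0 (- (ln s + n))"
        by (auto simp: excess_def)
      \<comment> \<open>the elementary bound \<open>u \<le> exp (\<beta> u) / \<beta>\<close>\<close>
      also have "\<dots> \<le> exp (\<beta> * (- (ln s + n))) / \<beta>"
        using exp_ge_add_one_self[of "\<beta> * (- (ln s + n))"] \<open>\<beta> > 0\<close> by (simp add: field_simps)
      also have "exp (\<beta> * (- (ln s + n))) = exp (- (\<beta> * n)) * s powr (- \<beta>)"
        using s by (simp add: powr_def algebra_simps flip: exp_add)
      finally have "\<bar>g t\<bar> * \<bar>excess n (z - of_real t)\<bar> \<le> \<bar>g t\<bar> * (exp (- (\<beta> * n)) * s powr (- \<beta>) / \<beta>)"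
        by (rule mult_left_mono) simp
      also have "\<dots> = exp (- (\<beta> * n)) / \<beta> * (\<bar>g t\<bar> * s powr (- \<beta>))"
        by simp
      also have "\<dots> \<le> exp (- (\<beta> * n)) / \<beta> * (\<bar>g t\<bar> powr p + s powr (- (1 / 2)))"
        unfolding \<beta>_def using s p mult_powr_le[of p "\<bar>g t\<bar>" s] by (intro mult_left_mono) auto
      also have "s powr (- (1 / 2)) = inv_sqrt_on L (x + (-1) * t)"
        using s by (auto simp: inv_sqrt_on_def s_def indicator_def)
      finally show ?thesis using True by (simp add: dom_def)
    next
      case False
      then show ?thesis using \<open>\<beta> > 0\<close> by (simp add: dom_def inv_sqrt_on_def)
    qed
    have AE_le: "AE t in lborel. norm (indicator {-M..M} t *\<^sub>R g t *\<^sub>R complex_of_real (excess n (z - of_real t))) \<le> dom t"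
      using AE_lborel_singleton[of x] by eventually_elim (rule le)
    have int_ex: "set_integrable lborel {-M..M} (\<lambda>t. g t *\<^sub>R complex_of_real (excess n (z - of_real t)))"
      unfolding set_integrable_def
      by (rule Bochner_Integration.integrable_bound[OF dom_int])
         (use AE_le in \<open>auto elim!: eventually_mono intro: order_trans[OF _ abs_ge_self]\<close>)
    have integrable: "set_integrable lborel {-M..M} (\<lambda>t. g t *\<^sub>R log_kernel (z - of_real t))"
      by (subst split[where n = n]) (rule set_integral_add(1)[OF int_F[OF z] int_ex])
    have "log_potential g M z = F n z + (LINT t:{-M..M}|lborel. g t *\<^sub>R complex_of_real (excess n (z - of_real t)))"
      unfolding F_def log_potential_def
      by (subst split[where n = n]) (rule set_integral_add(2)[OF int_F[OF z] int_ex])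
    then have "norm (F n z - log_potential g M z) =
        norm (LINT t:{-M..M}|lborel. g t *\<^sub>R complex_of_real (excess n (z - of_real t)))" by simp
    also have "\<dots> \<le> (LINT t|lborel. norm (indicator {-M..M} t *\<^sub>R g t *\<^sub>R complex_of_real (excess n (z - of_real t))))"
      unfolding set_lebesgue_integral_def by (rule integral_norm_bound)
    also have "\<dots> \<le> (LINT t|lborel. dom t)"
      using int_ex dom_int AE_le unfolding set_integrable_def
      by (intro integral_mono_AE integrable_norm)
    also have "\<dots> = exp (- (\<beta> * n)) / \<beta> * C"
    proof -
      have "(LINT t|lborel. inv_sqrt_on L (x + (-1) * t)) = (LINT s|lborel. inv_sqrt_on L s)"
        using lborel_integral_real_affine[of "-1" "inv_sqrt_on L" x] by simp
      moreover have "integrable lborel (\<lambda>t. inv_sqrt_on L (x + (-1) * t))"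
        using r M by (intro lborel_integrable_real_affine integrable_inv_sqrt_on) (auto simp: L_def)
      ultimately show ?thesis using gp by (simp add: dom_def C_def)
    qed
    finally have "norm (F n z - log_potential g M z) \<le> exp (- (\<beta> * n)) / \<beta> * C" .
    with integrable show ?thesis by blast
  qed
  have "(\<lambda>n. exp (- (\<beta> * real n))) \<longlonglongrightarrow> 0"
    using \<open>\<beta> > 0\<close> by (intro filterlim_compose[OF exp_at_bot])
      (auto simp: filterlim_uminus_at_bot intro!: filterlim_tendsto_pos_mult_at_top filterlim_real_sequentially)
  then have "(\<lambda>n. exp (- (\<beta> * real n)) / \<beta> * C) \<longlonglongrightarrow> 0 / \<beta> * C"
    by (intro tendsto_intros) (use \<open>\<beta> > 0\<close> in auto)
  then have small: "(\<lambda>n. exp (- (\<beta> * real n)) / \<beta> * C) \<longlonglongrightarrow> 0" by simp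
  have "uniform_limit ?A F (log_potential g M) sequentially"
    unfolding uniform_limit_iff
  proof (intro allI impI)
    fix e :: real assume "e > 0"
    from order_tendstoD(2)[OF small this]
    show "\<forall>\<^sub>F n in sequentially. \<forall>z\<in>?A. dist (F n z) (log_potential g M z) < e"
    proof eventually_elim
      case (elim n)
      show ?case
      proof
        fix z assume "z \<in> ?A"
        then show "dist (F n z) (log_potential g M z) < e"
          using diff[of z n] elim by (auto simp: dist_norm)
      qed
    qed
  qed
  then show "continuous_on ?A (log_potential g M)"
    by (rule uniform_limit_theorem[rotated]) (auto simp: cont_F)
  show "set_integrable lborel {-M..M} (\<lambda>t. g t *\<^sub>R log_kernel (z - of_real t))"
    if "norm z \<le> r" "Im z \<ge> 0" for z
    using diff[of z 0] that by simp
qed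

section \<open>The Cauchy transform of a compactly supported density\<close>

lemma Im_log_kernel_of_real:
  assumes "u \<noteq> 0"
  shows "Im (log_kernel (of_real u)) = (if u > 0 then - (pi / 2) else pi / 2)"
proof (cases "u > 0")
  case True
  have "log_kernel (of_real u) = Ln (of_real u * (- \<i>))" by (simp add: log_kernel_def mult.commute)
  also have "\<dots> = of_real (ln u) + Ln (- \<i>)" using True by (subst Ln_times_of_real) (auto simp: Ln_of_real simp flip: of_real_minus)
  finally show ?thesis using True by (simp add: Ln_of_real)
next
  case False
  then have "-u > 0" using assms by simp
  have "log_kernel (of_real u) = Ln (of_real (-u) * \<i>)" by (simp add: log_kernel_def mult.commute)
  also have "\<dots> = of_real (ln (-u)) + Ln \<i>" using \<open>-u > 0\<close> by (subst Ln_times_of_real) (auto simp: Ln_of_real simp flip: of_real_minus)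
  finally show ?thesis using False by simp
qed

text \<open>The regularity of the density enters through its representation as a primitive of \<open>g\<close>. The
  open interval makes it vanish at both end points, so that \<open>g\<close> has mean zero on
  \<open>{-M..M}\<close>.\<close>

locale compact_density =
  fixes \<rho> g :: "real \<Rightarrow> real" and M :: real
  assumes M: "M > 0"
    and \<rho>_cont: "continuous_on UNIV \<rho>"
    and \<rho>_outside: "\<And>x. x \<notin> {-M<..<M} \<Longrightarrow> \<rho> x = 0"
    and \<rho>_nonneg: "\<And>x. 0 \<le> \<rho> x"
    and g_meas: "g \<in> borel_measurable borel"
    and g_int: "\<And>a b. set_integrable lborel {a..b} g"
    and FTC: "\<And>a b. a \<le> b \<Longrightarrow> (LINT t:{a..b}|lborel. g t) = \<rho> b - \<rho> a"
begin

definition cauchy_transform :: "complex \<Rightarrow> complex" where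
  "cauchy_transform z = integral {-M..M} (\<lambda>t. of_real (\<rho> t) / (z - of_real t))"

text \<open>On the real axis the imaginary part of the kernel \<open>log_kernel (x - t)\<close> jumps from
  \<open>-\<pi>/2\<close> for \<open>t < x\<close> to \<open>\<pi>/2\<close> for \<open>t > x\<close>. Since \<open>g\<close> has mean zero, only the jump
  contributes, namely \<open>-\<pi>\<close> times the integral of \<open>g\<close> up to \<open>x\<close>.\<close>

lemma Im_log_potential_of_real:
  assumes "set_integrable lborel {-M..M} (\<lambda>t. g t *\<^sub>R log_kernel (of_real x - of_real t))"
  shows "Im (log_potential g M (of_real x)) = - pi * \<rho> x"
proof -
  define T where "T = {-M..M} \<inter> {..x}"
  have gT: "set_integrable lborel T g"
    by (rule set_integrable_subset[OF g_int[of "-M" M]]) (auto simp: T_def)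
  have "(LINT t:T|lborel. g t) = \<rho> x"
  proof -
    consider "x < -M" | "-M \<le> x" "x \<le> M" | "x > M" by linarith
    then show ?thesis
    proof cases
      case 1
      then have "T = {}" by (auto simp: T_def)
      then show ?thesis using 1 \<rho>_outside[of x] by (simp add: set_lebesgue_integral_def)
    next
      case 2
      then have "T = {-M..x}" by (auto simp: T_def)
      then show ?thesis using 2 FTC[of "-M" x] \<rho>_outside[of "-M"] by simp
    next
      case 3
      then have "T = {-M..M}" by (auto simp: T_def)
      then show ?thesis using 3 M FTC[of "-M" M] \<rho>_outside[of "-M"] \<rho>_outside[of M] \<rho>_outside[of x] by simp
    qed
  qed
  moreover have "(LINT t:{-M..M}|lborel. g t) = 0"
    using M FTC[of "-M" M] \<rho>_outside[of "-M"] \<rho>_outside[of M] by simp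
  moreover have "Im (log_potential g M (of_real x)) = (LINT t|lborel. Im (indicator {-M..M} t *\<^sub>R g t *\<^sub>R log_kernel (of_real x - of_real t)))"
    using assms unfolding log_potential_def set_lebesgue_integral_def set_integrable_def
    by (rule integral_bounded_linear[OF bounded_linear_Im, symmetric])
  moreover have "\<dots> = (LINT t|lborel. (pi / 2) * (indicator {-M..M} t *\<^sub>R g t) - pi * (indicator T t *\<^sub>R g t))"
  proof (rule integral_cong_AE)
    show "AE t in lborel. Im (indicator {-M..M} t *\<^sub>R g t *\<^sub>R log_kernel (of_real x - of_real t))
        = (pi / 2) * (indicator {-M..M} t *\<^sub>R g t) - pi * (indicator T t *\<^sub>R g t)"
      using AE_lborel_singleton[of x]
    proof eventually_elim
      case (elim t)
      then show ?case
        using Im_log_kernel_of_real[of "x - t"] by (auto simp: indicator_def T_def)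
    qed
  qed (use g_meas in \<open>simp_all add: T_def\<close>)
  moreover have "\<dots> = (pi / 2) * (LINT t:{-M..M}|lborel. g t) - pi * (LINT t:T|lborel. g t)"
    using g_int[of "-M" M] gT unfolding set_lebesgue_integral_def set_integrable_def by simp
  ultimately show ?thesis by simp
qed

lemma log_kernel_difference:
  assumes z: "Im z > 0" and "s \<le> b"
  shows "(LINT t:{s..b}|lborel. 1 / (z - of_real t)) = log_kernel (z - of_real s) - log_kernel (z - of_real b)"
proof -
  have ne: "z - of_real t \<noteq> 0" for t using z by (auto simp: complex_eq_iff)
  have "(LINT t|lborel. indicator {s..b} t *\<^sub>R (1 / (z - of_real t)))
      = (- log_kernel (z - of_real b)) - (- log_kernel (z - of_real s))"
  proof (rule integral_FTC_Icc)
    show "s \<le> b" by fact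
    show "continuous_on {s..b} (\<lambda>t. 1 / (z - complex_of_real t))"
      using ne by (intro continuous_intros) auto
    fix t assume "s \<le> t" "t \<le> b"
    have "((\<lambda>w. - log_kernel (z - w)) has_field_derivative 1 / (z - of_real t)) (at (of_real t))"
      unfolding log_kernel_def
      using z ne[of t] upper_rotated_notin_nonpos[of "z - of_real t"]
      by (auto intro!: derivative_eq_intros simp: field_simps)
    then have "((\<lambda>t. - log_kernel (z - of_real t)) has_vector_derivative 1 / (z - of_real t)) (at t)"
      using has_vector_derivative_real_field by blast
    then show "((\<lambda>t. - log_kernel (z - of_real t)) has_vector_derivative 1 / (z - of_real t)) (at t within {s..b})"
      by (rule has_vector_derivative_at_within)
  qed
  then show ?thesis by (simp add: set_lebesgue_integral_def)
qed

lemma cauchy_transform_LINT: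
  assumes "Im z \<noteq> 0"
  shows "integrable lborel (\<lambda>t. of_real (\<rho> t) / (z - of_real t))"
    and "cauchy_transform z = (LINT t|lborel. of_real (\<rho> t) / (z - of_real t))"
proof -
  have ne: "z - of_real t \<noteq> 0" for t using assms by (auto simp: complex_eq_iff)
  show int: "integrable lborel (\<lambda>t. of_real (\<rho> t) / (z - of_real t))"
  proof (rule integrable_compactly_supported[of _ "-M" M])
    show "continuous_on UNIV (\<lambda>t. of_real (\<rho> t) / (z - of_real t))"
      using ne by (intro continuous_intros \<rho>_cont) auto
  qed (use \<rho>_outside in auto)
  have eq: "(\<lambda>t. indicator {-M..M} t *\<^sub>R (of_real (\<rho> t) / (z - of_real t))) = (\<lambda>t. of_real (\<rho> t) / (z - of_real t))"
  proof
    fix t show "indicator {-M..M} t *\<^sub>R (of_real (\<rho> t) / (z - of_real t)) = of_real (\<rho> t) / (z - of_real t)"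
      using \<rho>_outside[of t] by (cases "t \<in> {-M<..<M}") auto
  qed
  have "set_integrable lborel {-M..M} (\<lambda>t. of_real (\<rho> t) / (z - of_real t))"
    unfolding set_integrable_def eq by (rule int)
  from set_borel_integral_eq_integral(2)[OF this]
  show "cauchy_transform z = (LINT t|lborel. of_real (\<rho> t) / (z - of_real t))"
    unfolding set_lebesgue_integral_def eq cauchy_transform_def by simp
qed

text \<open>Integration by parts. As \<open>g\<close> is merely integrable, it is carried out with Fubini's theorem for
  \<open>g(s) / (z - t)\<close> on the triangle \<open>-M \<le> s \<le> t \<le> M\<close>: integrating over \<open>s\<close> gives the density,
  integrating over \<open>t\<close> gives a difference of two values of the kernel, of which the one at \<open>M\<close> is
  killed by the mean value zero of \<open>g\<close>.\<close>

lemma cauchy_transform_eq_log_potential: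
  assumes z: "Im z > 0"
    and int_pot: "set_integrable lborel {-M..M} (\<lambda>t. g t *\<^sub>R log_kernel (z - of_real t))"
  shows "cauchy_transform z = log_potential g M z"
proof -
  note [measurable] = g_meas
  have ne: "z - of_real t \<noteq> 0" for t using z by (auto simp: complex_eq_iff)
  define f where "f s t = (indicator {-M..M} s * indicator {s..M} t * g s) *\<^sub>R (1 / (z - of_real t))" for s t
  have fm: "case_prod f \<in> borel_measurable (lborel \<Otimes>\<^sub>M lborel)"
  proof -
    have "(\<lambda>x. indicator {-M..M} (fst x) * (if fst x \<le> snd x \<and> snd x \<le> M then 1 else 0) * g (fst x)) \<in> borel_measurable (lborel \<Otimes>\<^sub>M lborel)"
      by measurable
    then have "(\<lambda>x. (indicator {-M..M} (fst x) * (if fst x \<le> snd x \<and> snd x \<le> M then 1 else 0) * g (fst x)) *\<^sub>R (1 / (z - of_real (snd x)))) \<in> borel_measurable (lborel \<Otimes>\<^sub>M lborel)"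
      by measurable
    then show ?thesis
      by (simp add: f_def case_prod_beta' indicator_def of_bool_def)
  qed
  have norm_f: "norm (f s t) \<le> (indicator {-M..M} s * \<bar>g s\<bar>) * (indicator {-M..M} t * (1 / Im z))" for s t
  proof -
    have "Im z \<le> norm (z - of_real t)" using abs_Im_le_cmod[of "z - of_real t"] z by simp
    then have "1 / norm (z - of_real t) \<le> 1 / Im z" using z ne[of t] by (intro divide_left_mono mult_pos_pos) auto
    then have "\<bar>g s\<bar> * (1 / norm (z - of_real t)) \<le> \<bar>g s\<bar> * (1 / Im z)"
      by (rule mult_left_mono) simp
    then show ?thesis
      using z by (auto simp: f_def indicator_def abs_mult norm_divide)
  qed
  have int2: "integrable lborel (\<lambda>t. f s t)" for s
  proof (rule Bochner_Integration.integrable_bound)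
    show "integrable lborel (\<lambda>t. (indicator {-M..M} s * \<bar>g s\<bar>) * (indicator {-M..M} t * (1 / Im z)))"
      by (intro integrable_mult_right integrable_mult_left integrable_real_indicator)
         (auto simp: emeasure_lborel_Icc_eq)
    show "AE t in lborel. norm (f s t) \<le> norm ((indicator {-M..M} s * \<bar>g s\<bar>) * (indicator {-M..M} t * (1 / Im z)))"
      unfolding real_norm_def by (intro AE_I2 order_trans[OF norm_f abs_ge_self])
  qed (simp add: f_def)
  have int: "integrable (lborel \<Otimes>\<^sub>M lborel) (case_prod f)"
  proof (rule lborel_pair.Fubini_integrable[OF fm])
    show "AE s in lborel. integrable lborel (\<lambda>t. case_prod f (s, t))" using int2 by simp
    show "integrable lborel (\<lambda>s. \<integral>t. norm (case_prod f (s, t)) \<partial>lborel)"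
    proof (rule Bochner_Integration.integrable_bound)
      show "integrable lborel (\<lambda>s. (indicator {-M..M} s * \<bar>g s\<bar>) * (LINT t|lborel. indicator {-M..M} t * (1 / Im z)))"
        using set_integrable_abs[OF g_int[of "-M" M]] by (intro integrable_mult_left) (simp add: set_integrable_def)
      show "(\<lambda>s. \<integral>t. norm (case_prod f (s, t)) \<partial>lborel) \<in> borel_measurable lborel"
        using fm by measurable
      show "AE s in lborel. norm (\<integral>t. norm (case_prod f (s, t)) \<partial>lborel)
          \<le> norm ((indicator {-M..M} s * \<bar>g s\<bar>) * (LINT t|lborel. indicator {-M..M} t * (1 / Im z)))"
      proof (rule AE_I2)
        fix s
        have "(\<integral>t. norm (f s t) \<partial>lborel) \<le> (\<integral>t. (indicator {-M..M} s * \<bar>g s\<bar>) * (indicator {-M..M} t * (1 / Im z)) \<partial>lborel)"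
          by (intro integral_mono integrable_norm int2 norm_f integrable_mult_right integrable_mult_left integrable_real_indicator)
            (auto simp: emeasure_lborel_Icc_eq)
        then show "norm (\<integral>t. norm (case_prod f (s, t)) \<partial>lborel)
          \<le> norm ((indicator {-M..M} s * \<bar>g s\<bar>) * (LINT t|lborel. indicator {-M..M} t * (1 / Im z)))"
          using M z by simp
      qed
    qed
  qed
  have inner_t: "(LINT t|lborel. f s t) = indicator {-M..M} s *\<^sub>R g s *\<^sub>R log_kernel (z - of_real s)
      - (indicator {-M..M} s *\<^sub>R g s) *\<^sub>R log_kernel (z - of_real M)" for s
  proof (cases "s \<in> {-M..M}")
    case True
    have "(LINT t|lborel. f s t) = (LINT t|lborel. g s *\<^sub>R (indicator {s..M} t *\<^sub>R (1 / (z - of_real t))))"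
      using True by (intro Bochner_Integration.integral_cong) (auto simp: f_def indicator_def)
    also have "\<dots> = g s *\<^sub>R (log_kernel (z - of_real s) - log_kernel (z - of_real M))"
      using log_kernel_difference[OF z, of s M] True
      by (simp add: set_lebesgue_integral_def del: scaleR_scaleR)
    finally show ?thesis using True by (simp add: algebra_simps)
  qed (simp add: f_def)
  have inner_s: "(LINT s|lborel. f s t) = of_real (\<rho> t) / (z - of_real t)" for t
  proof (cases "t \<in> {-M..M}")
    case True
    have "(LINT s|lborel. f s t) = (LINT s|lborel. (indicator {-M..t} s *\<^sub>R g s) *\<^sub>R (1 / (z - of_real t)))"
      using True by (intro Bochner_Integration.integral_cong) (auto simp: f_def indicator_def)
    also have "\<dots> = (LINT s:{-M..t}|lborel. g s) *\<^sub>R (1 / (z - of_real t))"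
      using g_int[of "-M" t] unfolding set_lebesgue_integral_def set_integrable_def
      by (intro integral_scaleR_left) simp
    also have "(LINT s:{-M..t}|lborel. g s) = \<rho> t"
      using True FTC[of "-M" t] \<rho>_outside[of "-M"] by simp
    finally show ?thesis by (simp add: scaleR_conv_of_real)
  next
    case False
    then have "f s t = 0" for s by (auto simp: f_def indicator_def)
    moreover have "\<rho> t = 0" using False by (intro \<rho>_outside) auto
    ultimately show ?thesis by simp
  qed
  have "cauchy_transform z = (LINT t|lborel. LINT s|lborel. f s t)"
    using z by (simp add: cauchy_transform_LINT(2) inner_s)
  also have "\<dots> = (LINT s|lborel. LINT t|lborel. f s t)"
    by (rule lborel_pair.Fubini_integral[OF int])
  also have "\<dots> = log_potential g M z - (LINT s:{-M..M}|lborel. g s) *\<^sub>R log_kernel (z - of_real M)"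
    using int_pot g_int[of "-M" M]
    unfolding inner_t log_potential_def set_lebesgue_integral_def set_integrable_def
    by (subst Bochner_Integration.integral_diff) auto
  also have "(LINT s:{-M..M}|lborel. g s) = 0"
    using M FTC[of "-M" M] \<rho>_outside[of "-M"] \<rho>_outside[of M] by simp
  finally show ?thesis by simp
qed

lemma cauchy_transform_holomorphic: "cauchy_transform holomorphic_on {z. Im z > 0}"
proof -
  have "(\<lambda>z. integral (cbox (-M) M) (\<lambda>t. of_real (\<rho> t) / (z - of_real t))) holomorphic_on {z. Im z > 0}"
  proof (rule leibniz_rule_holomorphic[where fx = "\<lambda>z t. - of_real (\<rho> t) / (z - of_real t) ^ 2"])
    have ne: "z - of_real t \<noteq> 0" if "z \<in> {z. Im z > 0}" for z t using that by (auto simp: complex_eq_iff)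
    show "((\<lambda>z. of_real (\<rho> t) / (z - of_real t)) has_field_derivative - of_real (\<rho> t) / (z - of_real t) ^ 2) (at z within {z. Im z > 0})"
      if "z \<in> {z. Im z > 0}" for z t
      using ne[OF that] by (auto intro!: derivative_eq_intros simp: power2_eq_square)
    show "(\<lambda>t. of_real (\<rho> t) / (z - of_real t)) integrable_on cbox (-M) M" if "z \<in> {z. Im z > 0}" for z
      using ne[OF that] by (intro integrable_continuous continuous_intros continuous_on_subset[OF \<rho>_cont]) auto
    have "continuous_on ({z. Im z > 0} \<times> cbox (-M) M) (\<lambda>x. - of_real (\<rho> (snd x)) / (fst x - of_real (snd x)) ^ 2)"
      using ne by (intro continuous_intros continuous_on_compose2[OF \<rho>_cont]) auto
    then show "continuous_on ({z. Im z > 0} \<times> cbox (-M) M) (\<lambda>(z, t). - of_real (\<rho> t) / (z - of_real t) ^ 2)"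
      by (simp add: case_prod_beta')
  qed (simp add: convex_halfspace_Im_gt)
  then show ?thesis by (simp add: cauchy_transform_def[abs_def])
qed

lemma norm_cauchy_transform_le:
  assumes "Im z \<noteq> 0" "norm z > M"
  shows "norm (cauchy_transform z) \<le> (LINT t|lborel. \<rho> t) / (norm z - M)"
proof -
  have int: "integrable lborel \<rho>"
    by (rule integrable_compactly_supported[OF \<rho>_cont, of "-M" M]) (use \<rho>_outside in auto)
  have "norm (cauchy_transform z) \<le> (LINT t|lborel. \<rho> t / (norm z - M))"
    unfolding cauchy_transform_LINT(2)[OF assms(1)]
  proof (rule Bochner_Integration.integral_norm_bound_integral)
    show "integrable lborel (\<lambda>t. \<rho> t / (norm z - M))" using int by simp
    fix t
    show "norm (of_real (\<rho> t) / (z - of_real t)) \<le> \<rho> t / (norm z - M)"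
    proof (cases "t \<in> {-M<..<M}")
      case True
      then have "norm z - M \<le> norm (z - of_real t)"
        using norm_triangle_ineq2[of z "of_real t"] by auto
      then show ?thesis using assms \<rho>_nonneg[of t] by (auto simp: norm_divide intro!: divide_left_mono mult_pos_pos)
    qed (use \<rho>_outside in simp)
  qed (rule cauchy_transform_LINT[OF assms(1)])
  then show ?thesis by simp
qed

end

section \<open>Winding numbers and crossings of a line\<close>

text \<open>The argument principle for a rectangle. It is applied on a slightly larger rectangle inside the
  half-plane, whose compact closure contains only finitely many solutions.\<close>

lemma winding_number_rectpath_image:
  assumes holo: "F holomorphic_on {z. Im z > 0}" and nonconst: "\<not> F constant_on {z. Im z > 0}"
    and ab: "Re a < Re b" "0 < Im a" "Im a < Im b"
    and avoid: "\<zeta> \<notin> F ` path_image (rectpath a b)"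
  shows "finite {z \<in> box a b. F z = \<zeta>}"
    and "winding_number (F \<circ> rectpath a b) \<zeta> = of_int (\<Sum>z\<in>{z \<in> box a b. F z = \<zeta>}. zorder (\<lambda>w. F w - \<zeta>) z)"
proof -
  define H where "H = {z. Im z > 0}"
  define f where "f w = F w - \<zeta>" for w
  have "open H" "connected H"
    by (auto simp: H_def open_halfspace_Im_gt convex_halfspace_Im_gt convex_connected)
  have f_holo: "f holomorphic_on H"
    unfolding f_def H_def by (intro holomorphic_intros holo)
  have f_nonconst: "\<not> f constant_on H"
    using nonconst unfolding constant_on_def f_def H_def by (metis diff_add_cancel)
  define a' b' where "a' = Complex (Re a - 1) (Im a / 2)" and "b' = Complex (Re b + 1) (Im b + 1)"
  define S where "S = box a' b'"
  have sub: "cbox a b \<subseteq> S" "cbox a' b' \<subseteq> H" "S \<subseteq> cbox a' b'"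
    using ab by (auto simp: S_def a'_def b'_def H_def in_box_complex_iff in_cbox_complex_iff)
  have path_sub: "path_image (rectpath a b) \<subseteq> cbox a b"
    using ab by (intro path_image_rectpath_subset_cbox) auto
  have fin': "finite {z \<in> cbox a' b'. f z = 0}"
    using holomorphic_compact_finite_zeros[OF f_holo \<open>open H\<close> \<open>connected H\<close> compact_cbox sub(2) f_nonconst] .
  define pz where "pz = {w \<in> S. f w = 0 \<or> w \<in> {}}"
  have pz: "finite pz" by (rule finite_subset[OF _ fin']) (use sub in \<open>auto simp: pz_def\<close>)
  show fin: "finite {z \<in> box a b. F z = \<zeta>}"
    by (rule finite_subset[OF _ pz]) (use sub(1) box_subset_cbox[of a b] in \<open>auto simp: pz_def f_def\<close>)
  have holo_S: "f holomorphic_on S" using f_holo sub by (meson holomorphic_on_subset order_trans)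
  have avoid_pz: "path_image (rectpath a b) \<subseteq> S - pz"
    using path_sub sub(1) avoid by (auto simp: pz_def f_def)
  have outside: "winding_number (rectpath a b) z = 0" if "z \<notin> cbox a b" for z
    using ab that path_sub by (intro winding_number_zero_outside[of _ "cbox a b"]) auto
  have "contour_integral (rectpath a b) (\<lambda>x. deriv f x * 1 / f x) = 2 * pi * \<i> *
          (\<Sum>p\<in>pz. winding_number (rectpath a b) p * 1 * zorder f p)"
    unfolding pz_def
  proof (rule argument_principle)
    show "open S" "connected S" by (auto simp: S_def convex_connected)
    show "f holomorphic_on S - {}" using holo_S by simp
    show "path_image (rectpath a b) \<subseteq> S - {w \<in> S. f w = 0 \<or> w \<in> {}}" using avoid_pz by (simp add: pz_def)
    show "\<forall>z. z \<notin> S \<longrightarrow> winding_number (rectpath a b) z = 0" using outside sub(1) by blast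
    show "finite {w \<in> S. f w = 0 \<or> w \<in> {}}" using pz by (simp add: pz_def)
  qed auto
  also have "(\<Sum>p\<in>pz. winding_number (rectpath a b) p * 1 * zorder f p)
      = (\<Sum>p\<in>{z \<in> box a b. F z = \<zeta>}. of_int (zorder f p))"
  proof (rule sum.mono_neutral_cong_right[OF pz])
    show "{z \<in> box a b. F z = \<zeta>} \<subseteq> pz"
      using sub(1) box_subset_cbox[of a b] by (auto simp: pz_def f_def)
    show "\<forall>p\<in>pz - {z \<in> box a b. F z = \<zeta>}. winding_number (rectpath a b) p * 1 * zorder f p = 0"
    proof
      fix p assume p: "p \<in> pz - {z \<in> box a b. F z = \<zeta>}"
      then have "p \<notin> box a b" "p \<notin> path_image (rectpath a b)" using avoid_pz by (auto simp: pz_def f_def)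
      then have "p \<notin> cbox a b" using path_image_rectpath_cbox_minus_box[of a b] ab by auto
      then show "winding_number (rectpath a b) p * 1 * zorder f p = 0" using outside by simp
    qed
    fix p assume "p \<in> {z \<in> box a b. F z = \<zeta>}"
    then show "winding_number (rectpath a b) p * 1 * zorder f p = of_int (zorder f p)"
      by (simp add: winding_number_rectpath)
  qed
  finally have AP: "contour_integral (rectpath a b) (\<lambda>x. deriv f x / f x) =
      2 * pi * \<i> * (\<Sum>p\<in>{z \<in> box a b. F z = \<zeta>}. of_int (zorder f p))" by simp
  have "winding_number (f \<circ> rectpath a b) 0 =
      1 / (2 * pi * \<i>) * contour_integral (f \<circ> rectpath a b) (\<lambda>w. 1 / (w - 0))"
  proof (rule winding_number_valid_path)
    show "valid_path (f \<circ> rectpath a b)"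
      by (rule valid_path_compose_holomorphic[OF _ holo_S])
         (use path_sub sub(1) in \<open>auto simp: S_def\<close>)
    show "0 \<notin> path_image (f \<circ> rectpath a b)"
      using avoid_pz by (auto simp: path_image_compose pz_def)
  qed
  also have "contour_integral (f \<circ> rectpath a b) (\<lambda>w. 1 / (w - 0)) =
      contour_integral (rectpath a b) (\<lambda>x. deriv f x / f x)"
  proof -
    have "f analytic_on S" using holo_S analytic_on_open[OF open_box[of a' b'], of f] by (simp add: S_def)
    then show ?thesis
      using contour_integral_comp_analyticW[of f S "rectpath a b" "\<lambda>w. 1 / (w - 0)"] path_sub sub(1)
      by auto
  qed
  also have "1 / (2 * pi * \<i>) * \<dots> = of_int (\<Sum>p\<in>{z \<in> box a b. F z = \<zeta>}. zorder f p)"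
    by (simp add: AP)
  finally show "winding_number (F \<circ> rectpath a b) \<zeta> = of_int (\<Sum>z\<in>{z \<in> box a b. F z = \<zeta>}. zorder (\<lambda>w. F w - \<zeta>) z)"
    by (subst winding_number_offset) (simp add: f_def[abs_def] o_def)
qed

text \<open>As \<open>v 0\<close> is not an integer, exactly \<open>k\<close> integers lie between \<open>v 0\<close> and \<open>v 0 + k\<close>, and the
  intermediate value theorem provides a parameter for each of them.\<close>

lemma integers_hit_le_card:
  fixes v :: "real \<Rightarrow> real"
  assumes cont: "continuous_on {0..1} v" and fin: "finite {t \<in> {0..1}. v t \<in> \<int>}"
    and v0: "v 0 \<notin> \<int>" and v1: "v 1 = v 0 + real k"
  shows "k \<le> card {t \<in> {0..1}. v t \<in> \<int>}"
proof -
  define I where "I = {\<lfloor>v 0\<rfloor> + 1..\<lfloor>v 0\<rfloor> + int k}"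
  have "\<exists>t\<in>{0..1}. v t = of_int i" if "i \<in> I" for i
  proof -
    have "v 0 \<le> of_int i" "of_int i \<le> v 1"
      using that v1 by (auto simp: I_def) linarith+
    then obtain t where "0 \<le> t" "t \<le> 1" "v t = of_int i"
      using IVT'[of v 0 "of_int i" 1] cont by auto
    then show ?thesis by auto
  qed
  then have "(of_int :: int \<Rightarrow> real) ` I \<subseteq> v ` {t \<in> {0..1}. v t \<in> \<int>}"
    by (force simp: image_iff)
  then have "card ((of_int :: int \<Rightarrow> real) ` I) \<le> card (v ` {t \<in> {0..1}. v t \<in> \<int>})"
    using fin by (intro card_mono) auto
  also have "\<dots> \<le> card {t \<in> {0..1}. v t \<in> \<int>}" using fin by (rule card_image_le)
  also have "card ((of_int :: int \<Rightarrow> real) ` I) = k"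
    by (subst card_image) (auto simp: I_def inj_on_def)
  finally show ?thesis .
qed

text \<open>Lift \<open>\<gamma> - \<zeta>\<close> to a continuous logarithm and let \<open>v\<close> be its imaginary part divided by \<open>\<pi>\<close>.
  Along the loop \<open>v\<close> rises by \<open>2 n\<close>, and it is an integer exactly when \<open>\<gamma>\<close> meets the
  horizontal line through \<open>\<zeta>\<close>. Hence there are at least \<open>2 n\<close> such parameters.\<close>

lemma winding_number_le_line_crossings:
  assumes path: "path \<gamma>" and avoid: "\<zeta> \<notin> path_image \<gamma>"
    and fin: "finite {t \<in> {0..1}. Im (\<gamma> t) = Im \<zeta>}" and start: "Im (\<gamma> 0) \<noteq> Im \<zeta>"
    and w: "winding_number \<gamma> \<zeta> = of_nat n"
  shows "2 * n \<le> card {t \<in> {0..1}. Im (\<gamma> t) = Im \<zeta>}"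
proof -
  obtain q where q: "path q" "pathfinish q - pathstart q = 2 * of_real pi * \<i> * winding_number \<gamma> \<zeta>"
    "\<And>t. t \<in> {0..1} \<Longrightarrow> \<gamma> t = \<zeta> + exp (q t)"
    using winding_number_as_continuous_log[OF path avoid] by blast
  define v where "v t = Im (q t) / pi" for t
  have iff: "v t \<in> \<int> \<longleftrightarrow> Im (\<gamma> t) = Im \<zeta>" if "t \<in> {0..1}" for t
  proof -
    have "Im (\<gamma> t) = Im \<zeta> \<longleftrightarrow> sin (Im (q t)) = 0"
      using q(3)[OF that] by (simp add: Im_exp)
    also have "\<dots> \<longleftrightarrow> (\<exists>i. Im (q t) = of_int i * pi)" by (rule sin_zero_iff_int2)
    also have "\<dots> \<longleftrightarrow> v t \<in> \<int>" by (auto simp: v_def Ints_def field_simps)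
    finally show ?thesis by simp
  qed
  then have eq: "{t \<in> {0..1}. v t \<in> \<int>} = {t \<in> {0..1}. Im (\<gamma> t) = Im \<zeta>}" by blast
  have "q 1 - q 0 = of_real (2 * n * pi) * \<i>"
    using q(2) w by (simp add: pathfinish_def pathstart_def)
  then have "Im (q 1) - Im (q 0) = 2 * n * pi" by (simp flip: minus_complex.sel)
  then have "v 1 = v 0 + real (2 * n)" by (simp add: v_def field_simps)
  moreover have "continuous_on {0..1} v"
    using q(1) unfolding v_def path_def by (intro continuous_intros) auto
  moreover have "v 0 \<notin> \<int>" using iff[of 0] start by simp
  ultimately show ?thesis using integers_hit_le_card[of v "2 * n"] fin unfolding eq by blast
qed

text \<open>Parameters of a rectangular loop are counted by the abscissas of the corresponding points if
  these all lie on the bottom side. The loop passes twice through its corner \<open>a\<close>, which therefore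
  has to be excluded.\<close>

lemma card_rectpath_bottom:
  assumes ab: "Re a < Re b" "Im a < Im b" and finX: "finite X" and corner: "\<not> P a"
    and only_bottom: "\<And>z. z \<in> path_image (rectpath a b) \<Longrightarrow> P z \<Longrightarrow> Im z = Im a \<and> Re z \<in> X"
  shows "finite {t \<in> {0..1}. P (rectpath a b t)}"
    and "card {t \<in> {0..1}. P (rectpath a b t)} \<le> card X"
proof -
  let ?T = "{t \<in> {0..1}. P (rectpath a b t)}"
  have lt: "t \<noteq> 0 \<and> t \<noteq> 1" if "t \<in> ?T" for t
    using that corner pathstart_rectpath[of a b] pathfinish_rectpath[of a b]
    by (auto simp: pathstart_def pathfinish_def)
  have loop_free: "loop_free (rectpath a b)"
    using simple_path_rectpath[of a b] ab by (auto simp: simple_path_def)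
  have bottom: "Im (rectpath a b t) = Im a \<and> Re (rectpath a b t) \<in> X" if "t \<in> ?T" for t
    using only_bottom[of "rectpath a b t"] that by (auto simp: path_image_def)
  have inj: "inj_on (\<lambda>t. Re (rectpath a b t)) ?T"
  proof (rule inj_onI)
    fix s t assume st: "s \<in> ?T" "t \<in> ?T" "Re (rectpath a b s) = Re (rectpath a b t)"
    then have "rectpath a b s = rectpath a b t"
      using bottom[OF st(1)] bottom[OF st(2)] by (auto intro: complex_eqI)
    then show "s = t"
      using loop_free lt[OF st(1)] lt[OF st(2)] st(1,2) unfolding loop_free_def by blast
  qed
  have sub: "(\<lambda>t. Re (rectpath a b t)) ` ?T \<subseteq> X" using bottom by blast
  show "finite ?T" using inj_on_finite[OF inj sub finX] .
  show "card ?T \<le> card X" using card_inj_on_le[OF inj sub finX] .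
qed

section \<open>Counting zeros by level sets\<close>

text \<open>The interiors of distinct level sets are disjoint open sets, so only countably many of them are
  nonempty. A nowhere dense set leaves an open interval near any level, in which countably many
  levels can be avoided.\<close>

lemma exists_generic_level:
  fixes \<rho> :: "real \<Rightarrow> real"
  assumes S: "nowhere_dense S" and "0 < d"
  shows "\<exists>y'. \<bar>y' - y\<bar> < d \<and> y' \<notin> S \<and> interior {x. \<rho> x = y'} = {}"
proof -
  define A where "A = {y. interior {x. \<rho> x = y} \<noteq> {}}"
  define I where "I y = interior {x. \<rho> x = y}" for y
  have I_sub: "I y \<subseteq> {x. \<rho> x = y}" for y unfolding I_def by (rule interior_subset)
  have "pairwise disjnt (I ` A)"
    unfolding pairwise_def disjnt_def
  proof (intro ballI impI)
    fix U V assume "U \<in> I ` A" "V \<in> I ` A" "U \<noteq> V"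
    then obtain y z where "U = I y" "V = I z" "y \<noteq> z" by blast
    then show "U \<inter> V = {}" using I_sub[of y] I_sub[of z] by auto
  qed
  then have "countable (I ` A)"
    by (intro countable_disjoint_open_subsets) (auto simp: I_def)
  moreover have "inj_on I A"
  proof (rule inj_onI)
    fix y z assume "y \<in> A" "I y = I z"
    then obtain x where "x \<in> I y" "x \<in> I z" by (auto simp: A_def I_def)
    then show "y = z" using I_sub by blast
  qed
  ultimately have "countable A" by (rule countable_image_inj_on)
  define U where "U = {y - d<..<y + d} - closure S"
  have "U \<noteq> {}"
  proof
    assume "U = {}"
    then have "{y - d<..<y + d} \<subseteq> interior (closure S)" by (intro interior_maximal) (auto simp: U_def)
    then show False using S \<open>0 < d\<close> by (auto simp: nowhere_dense_def)
  qed
  moreover have "open U" by (auto simp: U_def)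
  ultimately obtain y' where "y' \<in> U" "y' \<notin> A" using open_minus_countable[OF \<open>countable A\<close>] by blast
  then show ?thesis
    using closure_subset[of S] by (intro exI[of _ y']) (auto simp: U_def A_def)
qed

text \<open>A component with two points contains the segment between them, hence an open interval. So
  without interior all components are singletons.\<close>

lemma finite_components_empty_interior:
  fixes A :: "real set"
  assumes fin: "finite (components A)" and "interior A = {}"
  shows "finite A" and "card A = card (components A)"
proof -
  have singleton: "connected_component_set A x = {x}" if "x \<in> A" for x
  proof (rule ccontr)
    assume "connected_component_set A x \<noteq> {x}"
    moreover have "x \<in> connected_component_set A x" using that by simp
    ultimately obtain y where y: "y \<in> connected_component_set A x" "y \<noteq> x" by blast
    let ?C = "connected_component_set A x"
    have "closed_segment x y \<subseteq> ?C"
      using y \<open>x \<in> ?C\<close> connected_connected_component[of A x]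
      by (meson closed_segment_subset is_interval_convex_1 is_interval_connected_1)
    also have "\<dots> \<subseteq> A" by (rule connected_component_subset)
    finally have "open_segment x y \<subseteq> A" by (auto simp: open_segment_def)
    moreover have "open (open_segment x y)" by (simp add: open_segment_eq_real_ivl)
    ultimately have "open_segment x y \<subseteq> interior A" by (rule interior_maximal)
    moreover have "open_segment x y \<noteq> {}" using y by simp
    ultimately show False using assms by auto
  qed
  have "components A = (\<lambda>x. {x}) ` A"
    unfolding components_def using singleton by auto
  moreover have inj: "inj_on (\<lambda>x. {x}) A" by (simp add: inj_on_def)
  ultimately show "finite A" "card A = card (components A)"
    using fin by (auto dest: finite_imageD simp: card_image)
qed

lemma norm_linepath_diff_le:
  assumes "norm (u - u') \<le> e" "norm (v - v') \<le> e" "0 \<le> s" "s \<le> 1"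
  shows "norm (linepath u v s - linepath u' v' s) \<le> e"
proof -
  have "linepath u v s - linepath u' v' s = (1 - s) *\<^sub>R (u - u') + s *\<^sub>R (v - v')"
    by (simp add: linepath_def algebra_simps)
  also have "norm \<dots> \<le> (1 - s) * norm (u - u') + s * norm (v - v')"
    using assms by (intro norm_triangle_le) simp
  also have "\<dots> \<le> (1 - s) * e + s * e" using assms by (intro add_mono mult_left_mono) auto
  finally show ?thesis by (simp add: algebra_simps)
qed

lemma norm_rectpath_diff_le:
  assumes "norm (a - a') \<le> e" "0 \<le> t" "t \<le> 1"
  shows "norm (rectpath a b t - rectpath a' b t) \<le> e"
proof -
  have "norm (Complex x (Im a) - Complex x (Im a')) = \<bar>Im (a - a')\<bar>" for x
    by (simp add: cmod_def)
  then have "norm (Complex x (Im a) - Complex x (Im a')) \<le> e" for x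
    using assms(1) abs_Im_le_cmod[of "a - a'"] by simp
  moreover have "norm (Complex (Re a) y - Complex (Re a') y) = \<bar>Re (a - a')\<bar>" for y
    by (simp add: cmod_def)
  then have "norm (Complex (Re a) y - Complex (Re a') y) \<le> e" for y
    using assms(1) abs_Re_le_cmod[of "a - a'"] by simp
  moreover have "0 \<le> e" using assms(1) norm_ge_zero order_trans by blast
  ultimately show ?thesis
    using assms unfolding rectpath_def Let_def joinpaths_def
    by (auto intro!: norm_linepath_diff_le)
qed

lemma zorder_pos_of_nonconstant:
  assumes "f holomorphic_on A" "open A" "connected A" "z \<in> A" "f z = 0" "\<exists>w\<in>A. f w \<noteq> 0"
  shows "zorder f z > 0"
  using zorder_exist_zero[OF assms(1-4,6)] assms(5) by auto

text \<open>The heart of the matter, for a function \<open>\<Phi>\<close> that is continuous on the closed upper half-plane,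
  holomorphic inside, small at infinity, and whose imaginary part on the real line is
  \<open>-\<pi> \<rho>\<close>. Zeros of \<open>\<Phi> - \<zeta>\<close> inside a large rectangle are counted by a winding number about \<open>\<zeta>\<close>.
  This number does not change when \<open>\<zeta>\<close> is moved slightly to a generic value \<open>\<zeta>'\<close>, and the count
  for \<open>\<zeta>'\<close> does not decrease when the bottom side is lowered towards the real axis. In the limit
  the bottom side is real; there the curve meets the horizontal line through \<open>\<zeta>'\<close> exactly at the
  points of one level set of \<open>\<rho>\<close>, and on the other sides it never does.\<close>

lemma zero_count_le_half_level_components:
  fixes \<Phi> :: "complex \<Rightarrow> complex" and \<rho> :: "real \<Rightarrow> real"
  assumes cont: "\<And>r. r \<ge> 0 \<Longrightarrow> continuous_on (cball 0 r \<inter> {z. Im z \<ge> 0}) \<Phi>"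
    and holo: "\<Phi> holomorphic_on {z. Im z > 0}"
    and bdry: "\<And>x. Im (\<Phi> (of_real x)) = - pi * \<rho> x"
    and decay: "\<And>e. e > 0 \<Longrightarrow> \<exists>R. \<forall>z. Im z > 0 \<longrightarrow> norm z \<ge> R \<longrightarrow> norm (\<Phi> z) < e"
    and \<rho>_outside: "\<And>x. x \<notin> {-M<..<M} \<Longrightarrow> \<rho> x = 0"
    and S: "nowhere_dense S"
    and levels: "\<And>y. 0 < y \<Longrightarrow> y \<notin> S \<Longrightarrow> finite (components {x. \<rho> x = y}) \<and> card (components {x. \<rho> x = y}) \<le> N"
    and \<zeta>: "Im \<zeta> < 0"
    and T: "finite T" "T \<subseteq> {z. Im z > 0 \<and> \<Phi> z = \<zeta>}"
  shows "2 * (\<Sum>z\<in>T. zorder (\<lambda>w. \<Phi> w - \<zeta>) z) \<le> int N"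
    and "\<And>z. z \<in> T \<Longrightarrow> zorder (\<lambda>w. \<Phi> w - \<zeta>) z > 0"
proof -
  define H where "H = {z. Im z > 0}"
  have H: "open H" "connected H"
    by (auto simp: H_def open_halfspace_Im_gt convex_halfspace_Im_gt convex_connected)
  define e0 where "e0 = - Im \<zeta> / 2"
  have "e0 > 0" using \<zeta> by (simp add: e0_def)
  obtain R0 where R0: "\<And>z. Im z > 0 \<Longrightarrow> norm z \<ge> R0 \<Longrightarrow> norm (\<Phi> z) < e0"
    using decay[OF \<open>e0 > 0\<close>] by blast
  have nonconst: "\<exists>w\<in>H. \<Phi> w \<noteq> c" if "z \<in> H" "\<Phi> z = c" "Im c < - e0" for z c
  proof -
    have "norm (\<Phi> (Complex 0 (\<bar>R0\<bar> + 1))) < e0" by (intro R0) (auto simp: cmod_def)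
    then have "\<Phi> (Complex 0 (\<bar>R0\<bar> + 1)) \<noteq> c" using that(3) abs_Im_le_cmod[of c] by auto
    then show ?thesis by (intro bexI[of _ "Complex 0 (\<bar>R0\<bar> + 1)"]) (auto simp: H_def)
  qed
  have pos: "zorder (\<lambda>w. \<Phi> w - c) z > 0" if "Im c < - e0" "\<Phi> z = c" "z \<in> H" for c z
  proof (rule zorder_pos_of_nonconstant[of _ H])
    show "(\<lambda>w. \<Phi> w - c) holomorphic_on H" using holo unfolding H_def by (intro holomorphic_intros)
    show "\<exists>w\<in>H. \<Phi> w - c \<noteq> 0" using nonconst[OF that(3,2,1)] by simp
  qed (use H that in auto)
  have Im_\<zeta>: "Im \<zeta> < - e0" using \<zeta> by (simp add: e0_def)
  show "zorder (\<lambda>w. \<Phi> w - \<zeta>) z > 0" if "z \<in> T" for z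
    using pos[OF Im_\<zeta>, of z] that T by (auto simp: H_def)
  show "2 * (\<Sum>z\<in>T. zorder (\<lambda>w. \<Phi> w - \<zeta>) z) \<le> int N"
  proof (cases "T = {}")
    case False
    then obtain z0 where z0: "z0 \<in> H" "\<Phi> z0 = \<zeta>" using T by (auto simp: H_def)
    have not_const: "\<not> \<Phi> constant_on {z. Im z > 0}"
      using nonconst[OF z0 Im_\<zeta>] z0 unfolding constant_on_def H_def by auto
    define R where "R = \<bar>R0\<bar> + \<bar>M\<bar> + (\<Sum>z\<in>T. norm z) + 1"
    have T_norm: "norm z < R" if "z \<in> T" for z
      using member_le_sum[of z T norm] T(1) that by (simp add: R_def)
    have "(\<Sum>z\<in>T. norm z) \<ge> 0" by (intro sum_nonneg) auto
    then have R: "R > 0" "R > R0" "R > M" by (auto simp: R_def)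
    define \<beta> where "\<beta> = Complex R R"
    define \<alpha> where "\<alpha> \<epsilon> = Complex (-R) \<epsilon>" for \<epsilon>
    have rect_points: "Im z \<ge> \<epsilon> \<and> \<bar>Re z\<bar> \<le> R \<and> Im z \<le> R \<and> (Im z = \<epsilon> \<or> norm z \<ge> R)"
      if "z \<in> path_image (rectpath (\<alpha> \<epsilon>) \<beta>)" "0 \<le> \<epsilon>" "\<epsilon> < R" for z \<epsilon>
    proof -
      have "(Re z = - R \<or> Re z = R) \<and> \<epsilon> \<le> Im z \<and> Im z \<le> R \<or> (Im z = \<epsilon> \<or> Im z = R) \<and> - R \<le> Re z \<and> Re z \<le> R"
        using that R by (auto simp: path_image_rectpath \<alpha>_def \<beta>_def)
      then show ?thesis using abs_Re_le_cmod[of z] abs_Im_le_cmod[of z] R that(2,3) by auto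
    qed
    have far: "Im (\<Phi> z) > - e0" if "Im z > 0" "norm z \<ge> R" for z
    proof -
      have "norm (\<Phi> z) < e0" using that R by (intro R0) auto
      then show ?thesis using abs_Im_le_cmod[of "\<Phi> z"] by linarith
    qed
    have cont_rect: "path (\<Phi> \<circ> rectpath (\<alpha> \<epsilon>) \<beta>)" if "0 \<le> \<epsilon>" "\<epsilon> < R" for \<epsilon>
    proof (rule path_continuous_image[OF path_rectpath])
      have "path_image (rectpath (\<alpha> \<epsilon>) \<beta>) \<subseteq> cball 0 (2 * R) \<inter> {z. Im z \<ge> 0}"
      proof
        fix z assume "z \<in> path_image (rectpath (\<alpha> \<epsilon>) \<beta>)"
        from rect_points[OF this that] that show "z \<in> cball 0 (2 * R) \<inter> {z. Im z \<ge> 0}"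
          using cmod_le[of z] by auto
      qed
      then show "continuous_on (path_image (rectpath (\<alpha> \<epsilon>) \<beta>)) \<Phi>"
        using cont[of "2 * R"] R continuous_on_subset by fastforce
    qed
    have loop: "pathfinish (\<Phi> \<circ> rectpath (\<alpha> \<epsilon>) \<beta>) = pathstart (\<Phi> \<circ> rectpath (\<alpha> \<epsilon>) \<beta>)" for \<epsilon>
      by (simp add: pathfinish_compose pathstart_compose)

    \<comment> \<open>Let the bottom side run below all points of \<open>T\<close> and avoid the finitely many zeros in
      the strip between \<open>\<epsilon>1 / 2\<close> and \<open>\<epsilon>1\<close>, so that the winding number about \<open>\<zeta>\<close> makes sense.\<close>
    define \<epsilon>1 where "\<epsilon>1 = Min (insert R (Im ` T))"
    have \<epsilon>1: "\<epsilon>1 > 0" "\<epsilon>1 \<le> R" "\<And>z. z \<in> T \<Longrightarrow> \<epsilon>1 \<le> Im z"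
      using T R by (auto simp: \<epsilon>1_def)
    define Z where "Z = {z \<in> cbox (\<alpha> (\<epsilon>1 / 2)) \<beta>. \<Phi> z - \<zeta> = 0}"
    have "finite Z"
      unfolding Z_def
    proof (rule holomorphic_compact_finite_zeros[of _ H])
      show "(\<lambda>w. \<Phi> w - \<zeta>) holomorphic_on H" using holo unfolding H_def by (intro holomorphic_intros)
      show "\<not> (\<lambda>w. \<Phi> w - \<zeta>) constant_on H"
        using not_const unfolding constant_on_def H_def by (metis diff_add_cancel)
      show "cbox (\<alpha> (\<epsilon>1 / 2)) \<beta> \<subseteq> H" using \<epsilon>1(1) by (auto simp: in_cbox_complex_iff \<alpha>_def H_def)
    qed (use H in auto)
    then have "countable (Im ` Z)" by (simp add: countable_finite)
    then obtain \<epsilon> where \<epsilon>: "\<epsilon>1 / 2 < \<epsilon>" "\<epsilon> < \<epsilon>1" "\<epsilon> \<notin> Im ` Z"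
      using open_minus_countable[of "Im ` Z" "{\<epsilon>1 / 2<..<\<epsilon>1}"] \<epsilon>1(1) by auto
    have "0 < \<epsilon>" using \<epsilon>1(1) \<epsilon>(1) by linarith
    have \<epsilon>R: "0 \<le> \<epsilon>" "\<epsilon> < R" using \<open>0 < \<epsilon>\<close> \<epsilon>(2) \<epsilon>1(2) by auto
    have avoid: "\<zeta> \<notin> \<Phi> ` path_image (rectpath (\<alpha> \<epsilon>) \<beta>)"
    proof
      assume "\<zeta> \<in> \<Phi> ` path_image (rectpath (\<alpha> \<epsilon>) \<beta>)"
      then obtain z where z: "z \<in> path_image (rectpath (\<alpha> \<epsilon>) \<beta>)" "\<Phi> z = \<zeta>" by auto
      from rect_points[OF z(1) \<epsilon>R] consider "Im z = \<epsilon>" | "norm z \<ge> R" "Im z > 0" using \<open>0 < \<epsilon>\<close> by auto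
      then show False
      proof cases
        case 1
        then have "z \<in> Z"
          using \<epsilon>(1) z rect_points[OF z(1) \<epsilon>R] by (auto simp: Z_def in_cbox_complex_iff \<alpha>_def \<beta>_def)
        then show False using 1 \<epsilon>(3) by blast
      next
        case 2
        then show False using far[of z] z(2) Im_\<zeta> by simp
      qed
    qed
    have T_box: "T \<subseteq> {z \<in> box (\<alpha> \<epsilon>) \<beta>. \<Phi> z = \<zeta>}"
    proof
      fix z assume "z \<in> T"
      then show "z \<in> {z \<in> box (\<alpha> \<epsilon>) \<beta>. \<Phi> z = \<zeta>}"
        using T_norm[of z] \<epsilon>1(3)[of z] \<epsilon>(2) T abs_Re_le_cmod[of z] abs_Im_le_cmod[of z]
        by (auto simp: in_box_complex_iff \<alpha>_def \<beta>_def)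
    qed

    \<comment> \<open>Move \<open>\<zeta>\<close> within a disc that the curve does not meet. First change the imaginary part, to
      reach an admissible level whose level set \<open>X\<close> has no interior and is thus a finite set; then
      change the real part, so that \<open>\<zeta>'\<close> is not one of the values that \<open>\<Phi>\<close> takes on \<open>X\<close>. This makes
      the boundary curve avoid \<open>\<zeta>'\<close>. The bound \<open>e0\<close> keeps \<open>\<zeta>'\<close> below the values of \<open>\<Phi>\<close> far out.\<close>
    have "closed (path_image (\<Phi> \<circ> rectpath (\<alpha> \<epsilon>) \<beta>))"
      using cont_rect[OF \<epsilon>R] by (rule closed_path_image)
    moreover have "\<zeta> \<notin> path_image (\<Phi> \<circ> rectpath (\<alpha> \<epsilon>) \<beta>)" using avoid by (simp add: path_image_compose)
    ultimately obtain \<delta> where \<delta>: "\<delta> > 0" "\<And>w. w \<in> path_image (\<Phi> \<circ> rectpath (\<alpha> \<epsilon>) \<beta>) \<Longrightarrow> \<delta> \<le> dist \<zeta> w"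
      using separate_point_closed by metis
    define d where "d = min \<delta> e0 / (2 * pi)"
    have "d > 0" using \<delta>(1) \<open>e0 > 0\<close> by (simp add: d_def)
    obtain y' where y': "\<bar>y' - (- Im \<zeta> / pi)\<bar> < d" "y' \<notin> S" "interior {x. \<rho> x = y'} = {}"
      using exists_generic_level[OF S \<open>d > 0\<close>] by blast
    have Im_near: "\<bar>- pi * y' - Im \<zeta>\<bar> < min \<delta> e0 / 2"
    proof -
      have "\<bar>- pi * y' - Im \<zeta>\<bar> = pi * \<bar>y' - (- Im \<zeta> / pi)\<bar>"
        by (simp add: abs_mult[symmetric] field_simps flip: abs_minus_cancel[of "- pi * y' - Im \<zeta>"])
      also have "\<dots> < pi * d" using y'(1) by (intro mult_strict_left_mono) auto
      finally show ?thesis by (simp add: d_def)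
    qed
    have Im_below: "- pi * y' < - e0"
    proof -
      have "\<bar>- pi * y' - Im \<zeta>\<bar> < e0 / 2" using Im_near by linarith
      then show ?thesis using \<open>e0 > 0\<close> unfolding e0_def by linarith
    qed
    then have "y' > 0" using \<open>e0 > 0\<close> by (smt (verit) mult_minus_left mult_pos_pos pi_gt_zero zero_less_mult_pos)
    define X where "X = {x. \<rho> x = y'}"
    have X: "finite X" "card X \<le> N"
      using levels[OF \<open>y' > 0\<close> y'(2)] finite_components_empty_interior[of X] y'(3) by (auto simp: X_def)
    have "countable ((\<lambda>x. Re (\<Phi> (of_real x))) ` X)" using X(1) by (simp add: countable_finite)
    then obtain x' where "x' \<in> {Re \<zeta> - \<delta> / 2<..<Re \<zeta> + \<delta> / 2}" and x'_notin: "x' \<notin> (\<lambda>x. Re (\<Phi> (of_real x))) ` X"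
      using open_minus_countable[of _ "{Re \<zeta> - \<delta> / 2<..<Re \<zeta> + \<delta> / 2}"] \<delta>(1) by fastforce
    then have x'_near: "\<bar>x' - Re \<zeta>\<bar> < \<delta> / 2" unfolding greaterThanLessThan_iff by linarith
    define \<zeta>' where "\<zeta>' = Complex x' (- pi * y')"
    have near: "dist \<zeta> \<zeta>' < \<delta>"
      using cmod_le[of "\<zeta>' - \<zeta>"] x'_near Im_near by (simp add: \<zeta>'_def dist_norm norm_minus_commute)
    have Im_\<zeta>': "Im \<zeta>' < - e0" using Im_below by (simp add: \<zeta>'_def)
    have ball: "ball \<zeta> \<delta> \<inter> path_image (\<Phi> \<circ> rectpath (\<alpha> \<epsilon>) \<beta>) = {}"
      using \<delta>(2) by fastforce
    have wind_eq: "winding_number (\<Phi> \<circ> rectpath (\<alpha> \<epsilon>) \<beta>) \<zeta> = winding_number (\<Phi> \<circ> rectpath (\<alpha> \<epsilon>) \<beta>) \<zeta>'"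
      by (rule winding_number_eq[OF cont_rect[OF \<epsilon>R] loop _ _ connected_ball ball]) (use \<delta>(1) near in auto)
    have avoid': "\<zeta>' \<notin> \<Phi> ` path_image (rectpath (\<alpha> \<epsilon>) \<beta>)"
      using ball near by (auto simp: path_image_compose)

    \<comment> \<open>The curve with real bottom side. By uniform continuity a rectangle at small height
      \<open>\<epsilon>' < \<epsilon>\<close> yields a curve so close to it that the winding numbers about \<open>\<zeta>'\<close> agree.\<close>
    define \<gamma> where "\<gamma> = \<Phi> \<circ> rectpath (\<alpha> 0) \<beta>"
    have "path \<gamma>" unfolding \<gamma>_def using R by (intro cont_rect) auto
    have level: "Im z = 0 \<and> Re z \<in> X" if z: "z \<in> path_image (rectpath (\<alpha> 0) \<beta>)" "Im (\<Phi> z) = Im \<zeta>'" for z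
    proof -
      have "Im z = 0"
      proof (rule ccontr)
        assume "Im z \<noteq> 0"
        then have "Im z > 0" "norm z \<ge> R" using rect_points[OF z(1)] R by auto
        then show False using far[of z] z(2) Im_\<zeta>' by simp
      qed
      then have "z = of_real (Re z)" by (simp add: complex_eq_iff)
      then have "\<rho> (Re z) = y'" using z(2) bdry[of "Re z"] by (simp add: \<zeta>'_def)
      then show ?thesis using \<open>Im z = 0\<close> by (simp add: X_def)
    qed
    have avoid0: "\<zeta>' \<notin> path_image \<gamma>"
    proof
      assume "\<zeta>' \<in> path_image \<gamma>"
      then obtain z where z: "z \<in> path_image (rectpath (\<alpha> 0) \<beta>)" "\<Phi> z = \<zeta>'"
        by (auto simp: \<gamma>_def path_image_compose)
      then have "z = of_real (Re z)" "Re z \<in> X" using level[of z] by (auto simp: complex_eq_iff)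
      then have "Re (\<Phi> z) \<noteq> x'" using x'_notin by (metis image_eqI)
      then show False using z(2) by (simp add: \<zeta>'_def)
    qed
    have corner: "Im (\<Phi> (\<alpha> 0)) \<noteq> Im \<zeta>'"
    proof -
      have "\<alpha> 0 = of_real (-R)" by (simp add: \<alpha>_def complex_eq_iff)
      then show ?thesis using bdry[of "-R"] \<rho>_outside[of "-R"] R \<open>y' > 0\<close> by (simp add: \<zeta>'_def)
    qed
    have "closed (path_image \<gamma>)" using \<open>path \<gamma>\<close> by (rule closed_path_image)
    then obtain \<eta> where \<eta>: "\<eta> > 0" "\<And>w. w \<in> path_image \<gamma> \<Longrightarrow> \<eta> \<le> dist \<zeta>' w"
      using separate_point_closed[OF _ avoid0] by metis
    define K where "K = cball 0 (2 * R) \<inter> {z::complex. Im z \<ge> 0}"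
    have "compact K" unfolding K_def by (intro compact_Int_closed compact_cball closed_halfspace_Im_ge)
    then have "uniformly_continuous_on K \<Phi>"
      using cont[of "2 * R"] R compact_uniformly_continuous unfolding K_def by auto
    then obtain \<kappa> where \<kappa>: "\<kappa> > 0" "\<And>u v. u \<in> K \<Longrightarrow> v \<in> K \<Longrightarrow> dist v u < \<kappa> \<Longrightarrow> dist (\<Phi> v) (\<Phi> u) < \<eta>"
      using \<open>\<eta> > 0\<close> unfolding uniformly_continuous_on_def by metis
    define \<epsilon>' where "\<epsilon>' = min \<epsilon> \<kappa> / 2"
    have \<epsilon>': "0 < \<epsilon>'" "\<epsilon>' < \<epsilon>" "\<epsilon>' < \<kappa>" using \<open>0 < \<epsilon>\<close> \<kappa>(1) by (auto simp: \<epsilon>'_def)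
    have \<epsilon>'R: "0 \<le> \<epsilon>'" "\<epsilon>' < R" using \<epsilon>' \<epsilon>R by auto
    have in_K: "rectpath (\<alpha> s) \<beta> t \<in> K" if "0 \<le> s" "s < R" "t \<in> {0..1}" for s t
    proof -
      have "rectpath (\<alpha> s) \<beta> t \<in> path_image (rectpath (\<alpha> s) \<beta>)" using that by (auto simp: path_image_def)
      from rect_points[OF this that(1,2)] show ?thesis
        using cmod_le[of "rectpath (\<alpha> s) \<beta> t"] that by (auto simp: K_def)
    qed
    have close: "norm ((\<Phi> \<circ> rectpath (\<alpha> \<epsilon>') \<beta>) t - \<gamma> t) < norm (\<gamma> t - \<zeta>')" if t: "t \<in> {0..1}" for t
    proof -
      have "norm (rectpath (\<alpha> \<epsilon>') \<beta> t - rectpath (\<alpha> 0) \<beta> t) \<le> \<epsilon>'"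
        using \<epsilon>' t by (intro norm_rectpath_diff_le) (auto simp: \<alpha>_def cmod_def)
      then have "dist (rectpath (\<alpha> \<epsilon>') \<beta> t) (rectpath (\<alpha> 0) \<beta> t) < \<kappa>" using \<epsilon>' by (simp add: dist_norm)
      then have "dist (\<Phi> (rectpath (\<alpha> \<epsilon>') \<beta> t)) (\<Phi> (rectpath (\<alpha> 0) \<beta> t)) < \<eta>"
        using \<epsilon>'R R t by (intro \<kappa>(2) in_K) auto
      also have "\<eta> \<le> dist \<zeta>' (\<gamma> t)" using t by (intro \<eta>(2)) (auto simp: path_image_def)
      finally show ?thesis by (simp add: \<gamma>_def dist_norm norm_minus_commute)
    qed
    have wind_eq': "winding_number (\<Phi> \<circ> rectpath (\<alpha> \<epsilon>') \<beta>) \<zeta>' = winding_number \<gamma> \<zeta>'"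
      by (rule winding_number_nearby_loops_eq[OF \<open>path \<gamma>\<close> cont_rect[OF \<epsilon>'R] _ loop close])
         (simp only: \<gamma>_def loop)
    have avoid'': "\<zeta>' \<notin> \<Phi> ` path_image (rectpath (\<alpha> \<epsilon>') \<beta>)"
    proof
      assume "\<zeta>' \<in> \<Phi> ` path_image (rectpath (\<alpha> \<epsilon>') \<beta>)"
      then obtain t where "t \<in> {0..1}" "\<Phi> (rectpath (\<alpha> \<epsilon>') \<beta> t) = \<zeta>'" by (auto simp: path_image_def)
      then show False using close[of t] by (simp add: norm_minus_commute)
    qed

    \<comment> \<open>The chain of counts: \<open>T\<close> is part of the zeros for \<open>\<zeta>\<close>, these are as many as for \<open>\<zeta>'\<close>, and
      the taller rectangle contains at least as many of the latter.\<close>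
    define cnt where "cnt c s = (\<Sum>z\<in>{z \<in> box (\<alpha> s) \<beta>. \<Phi> z = c}. zorder (\<lambda>w. \<Phi> w - c) z)" for c s
    have AP: "finite {z \<in> box (\<alpha> s) \<beta>. \<Phi> z = c}"
      "winding_number (\<Phi> \<circ> rectpath (\<alpha> s) \<beta>) c = of_int (cnt c s)"
      if "0 < s" "s < R" "c \<notin> \<Phi> ` path_image (rectpath (\<alpha> s) \<beta>)" for c s
      unfolding cnt_def
      by (rule winding_number_rectpath_image[OF holo not_const _ _ _ that(3)];
          use that R in \<open>simp add: \<alpha>_def \<beta>_def\<close>)+
    have box_H: "z \<in> H" if "z \<in> box (\<alpha> s) \<beta>" "0 < s" for z s
      using that by (auto simp: in_box_complex_iff \<alpha>_def H_def)
    have "(\<Sum>z\<in>T. zorder (\<lambda>w. \<Phi> w - \<zeta>) z) \<le> cnt \<zeta> \<epsilon>"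
      unfolding cnt_def
    proof (rule sum_mono2[OF AP(1)[OF \<open>0 < \<epsilon>\<close> \<epsilon>R(2) avoid] T_box])
      fix z assume "z \<in> {z \<in> box (\<alpha> \<epsilon>) \<beta>. \<Phi> z = \<zeta>} - T"
      then show "0 \<le> zorder (\<lambda>w. \<Phi> w - \<zeta>) z"
        using pos[OF Im_\<zeta>, of z] box_H[of z \<epsilon>] \<open>0 < \<epsilon>\<close> by auto
    qed
    also have "cnt \<zeta> \<epsilon> = cnt \<zeta>' \<epsilon>"
      using AP(2)[OF \<open>0 < \<epsilon>\<close> \<epsilon>R(2) avoid] AP(2)[OF \<open>0 < \<epsilon>\<close> \<epsilon>R(2) avoid'] wind_eq by simp
    also have "\<dots> \<le> cnt \<zeta>' \<epsilon>'"
      unfolding cnt_def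
    proof (rule sum_mono2[OF AP(1)[OF \<epsilon>'(1) \<epsilon>'R(2) avoid'']])
      show "{z \<in> box (\<alpha> \<epsilon>) \<beta>. \<Phi> z = \<zeta>'} \<subseteq> {z \<in> box (\<alpha> \<epsilon>') \<beta>. \<Phi> z = \<zeta>'}"
        using \<epsilon>' by (auto simp: in_box_complex_iff \<alpha>_def)
      fix z assume "z \<in> {z \<in> box (\<alpha> \<epsilon>') \<beta>. \<Phi> z = \<zeta>'} - {z \<in> box (\<alpha> \<epsilon>) \<beta>. \<Phi> z = \<zeta>'}"
      then show "0 \<le> zorder (\<lambda>w. \<Phi> w - \<zeta>') z"
        using pos[OF Im_\<zeta>', of z] box_H[of z \<epsilon>'] \<epsilon>'(1) by auto
    qed
    finally have le: "(\<Sum>z\<in>T. zorder (\<lambda>w. \<Phi> w - \<zeta>) z) \<le> cnt \<zeta>' \<epsilon>'" .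
    have "0 \<le> cnt \<zeta>' \<epsilon>'"
      unfolding cnt_def
    proof (rule sum_nonneg)
      fix z assume "z \<in> {z \<in> box (\<alpha> \<epsilon>') \<beta>. \<Phi> z = \<zeta>'}"
      then show "0 \<le> zorder (\<lambda>w. \<Phi> w - \<zeta>') z"
        using pos[OF Im_\<zeta>', of z] box_H[of z \<epsilon>'] \<epsilon>'(1) by auto
    qed
    then have wind: "winding_number \<gamma> \<zeta>' = of_nat (nat (cnt \<zeta>' \<epsilon>'))"
      using AP(2)[OF \<epsilon>'(1) \<epsilon>'R(2) avoid''] wind_eq' by simp
    have crossings: "finite {t \<in> {0..1}. Im (\<gamma> t) = Im \<zeta>'}" "card {t \<in> {0..1}. Im (\<gamma> t) = Im \<zeta>'} \<le> card X"
      unfolding \<gamma>_def o_def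
      by (rule card_rectpath_bottom[where P = "\<lambda>z. Im (\<Phi> z) = Im \<zeta>'", OF _ _ X(1) corner];
          use R level in \<open>simp add: \<alpha>_def \<beta>_def\<close>)+
    have "\<gamma> 0 = \<Phi> (\<alpha> 0)"
      using pathstart_rectpath[of "\<alpha> 0" \<beta>] by (simp add: \<gamma>_def pathstart_def)
    then have "2 * nat (cnt \<zeta>' \<epsilon>') \<le> card {t \<in> {0..1}. Im (\<gamma> t) = Im \<zeta>'}"
      using winding_number_le_line_crossings[OF \<open>path \<gamma>\<close> avoid0 crossings(1) _ wind] corner by simp
    then have "2 * nat (cnt \<zeta>' \<epsilon>') \<le> N" using crossings(2) X(2) by linarith
    then show ?thesis using le by linarith
  qed simp
qed

section \<open>Solutions of the Stieltjes transform equation\<close>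

text \<open>Conjugating a local factorisation \<open>f(w) = g(w) (w - z)\<^sup>n\<close> on both sides gives one of \<open>h\<close> at the
  conjugate point.\<close>

lemma zorder_cnj_symmetric:
  assumes holo: "f holomorphic_on A" and A: "open A" "connected A" "z \<in> A" and nz: "\<exists>w\<in>A. f w \<noteq> 0"
    and sym: "\<And>w. w \<in> A \<Longrightarrow> h (cnj w) = cnj (f w)"
  shows "zorder h (cnj z) = zorder f z"
proof -
  define g where "g = zor_poly f z"
  obtain r where r: "r > 0" "cball z r \<subseteq> A" "g holomorphic_on cball z r"
    "\<And>w. w \<in> cball z r \<Longrightarrow> f w = g w * (w - z) ^ nat (zorder f z) \<and> g w \<noteq> 0"
    using zorder_exist_zero[OF holo A nz] unfolding g_def by blast
  have order: "zorder f z \<ge> 0"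
    using zorder_exist_zero[OF holo A nz] by (auto split: if_splits)
  have cnj_ball: "cnj ` ball (cnj z) r = ball z r"
  proof -
    have "w \<in> cnj ` ball (cnj z) r \<longleftrightarrow> w \<in> ball z r" for w
    proof -
      have "w \<in> cnj ` ball (cnj z) r \<longleftrightarrow> cnj w \<in> ball (cnj z) r"
        by (metis complex_cnj_cnj image_iff)
      also have "\<dots> \<longleftrightarrow> w \<in> ball z r" by (simp add: dist_norm flip: complex_cnj_diff)
      finally show ?thesis .
    qed
    then show ?thesis by blast
  qed
  show ?thesis
  proof (rule zorder_eqI[where S = "ball (cnj z) r" and g = "cnj \<circ> g \<circ> cnj"])
    show "cnj \<circ> g \<circ> cnj holomorphic_on ball (cnj z) r"
      using r(3) by (intro holomorphic_on_compose_cnj_cnj) (auto simp: cnj_ball)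
    show "(cnj \<circ> g \<circ> cnj) (cnj z) \<noteq> 0" using r(1) r(4)[of z] by auto
    fix w assume w: "w \<in> ball (cnj z) r"
    then have "cnj w \<in> cball z r" using cnj_ball by (metis ball_subset_cball image_eqI subsetD)
    then have "f (cnj w) = g (cnj w) * (cnj w - z) ^ nat (zorder f z)" "cnj w \<in> A" using r by auto
    moreover from this(2) have "h w = cnj (f (cnj w))" using sym[of "cnj w"] by simp
    ultimately show "h w = (cnj \<circ> g \<circ> cnj) w * (w - cnj z) powi zorder f z"
      using order by (simp add: power_int_def)
  qed (use r(1) in auto)
qed

lemma density_eq_0_outside_support:
  assumes \<mu>: "\<mu> = density lborel (\<lambda>x. ennreal (\<rho> x))" and cont: "continuous_on UNIV \<rho>"
    and nonneg: "\<And>x. \<rho> x \<ge> 0" and x: "x \<notin> measure_support \<mu>"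
  shows "\<rho> x = 0"
proof (rule ccontr)
  assume "\<rho> x \<noteq> 0"
  then have "\<rho> x > 0" using nonneg[of x] by simp
  obtain U where U: "open U" "x \<in> U" "emeasure \<mu> U = 0"
    using x by (auto simp: measure_support_def zero_less_iff_neq_zero)
  define V where "V = U \<inter> {t. \<rho> x / 2 < \<rho> t}"
  have "open {t. \<rho> x / 2 < \<rho> t}" using cont by (intro open_Collect_less continuous_intros)
  then have "open V" "x \<in> V" using U \<open>\<rho> x > 0\<close> by (auto simp: V_def)
  have [measurable]: "\<rho> \<in> borel_measurable borel" using cont by (rule borel_measurable_continuous_onI)
  have "0 < ennreal (\<rho> x / 2) * emeasure lborel V"
    using \<open>\<rho> x > 0\<close> \<open>open V\<close> \<open>x \<in> V\<close> open_not_negligible[of V]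
    by (auto simp: zero_less_iff_neq_zero ennreal_zero_less_mult_iff negligible_iff_null_sets null_sets_def)
  also have "\<dots> = (\<integral>\<^sup>+t. ennreal (\<rho> x / 2) * indicator V t \<partial>lborel)"
    using \<open>open V\<close> by (simp add: nn_integral_cmult_indicator)
  also have "\<dots> \<le> (\<integral>\<^sup>+t. ennreal (\<rho> t) * indicator U t \<partial>lborel)"
    by (intro nn_integral_mono) (auto simp: V_def indicator_def intro!: ennreal_leI)
  also have "\<dots> = emeasure \<mu> U" using U(1) by (simp add: \<mu> emeasure_density)
  finally show False using U(3) by simp
qed

lemma bounded_of_continuous_vanishing:
  fixes f :: "real \<Rightarrow> real"
  assumes "continuous_on UNIV f" "\<And>x. x \<notin> {a..b} \<Longrightarrow> f x = 0"
  shows "\<exists>C. \<forall>x. \<bar>f x\<bar> \<le> C"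
proof -
  have "compact (f ` {a..b})" using assms(1) by (intro compact_continuous_image continuous_on_subset[OF assms(1)]) auto
  then obtain C where C: "\<And>y. y \<in> f ` {a..b} \<Longrightarrow> norm y \<le> C"
    using compact_imp_bounded bounded_iff by metis
  have "\<bar>f x\<bar> \<le> \<bar>C\<bar>" for x using C[of "f x"] assms(2)[of x] by (cases "x \<in> {a..b}") auto
  then show ?thesis by blast
qed

text \<open>A bound on the weighted count over all finite sets of solutions suffices: as the
  multiplicities are positive, it also bounds the cardinality of these sets and so forces the set of
  solutions to be finite.\<close>

lemma num_solutions_leI:
  assumes pos: "\<And>z. z \<in> D \<Longrightarrow> F z = \<zeta> \<Longrightarrow> zorder (\<lambda>w. F w - \<zeta>) z > 0"
    and le: "\<And>T. finite T \<Longrightarrow> T \<subseteq> {z \<in> D. F z = \<zeta>} \<Longrightarrow> 2 * (\<Sum>z\<in>T. zorder (\<lambda>w. F w - \<zeta>) z) \<le> int N"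
  obtains k where "num_solutions F D \<zeta> = enat k" "2 * k \<le> N"
proof -
  define Z where "Z = {z \<in> D. F z = \<zeta>}"
  have "card T \<le> N" if "finite T" "T \<subseteq> Z" for T
  proof -
    have "int (card T) \<le> (\<Sum>z\<in>T. zorder (\<lambda>w. F w - \<zeta>) z)"
      using sum_mono[of T "\<lambda>_. 1 :: int" "\<lambda>z. zorder (\<lambda>w. F w - \<zeta>) z"] pos that(2)
      by (fastforce simp: Z_def)
    then show ?thesis using le[OF that(1)] that(2) by (simp add: Z_def)
  qed
  then have "finite Z" using finite_if_finite_subsets_card_bdd by metis
  define k where "k = (\<Sum>z\<in>Z. nat (zorder (\<lambda>w. F w - \<zeta>) z))"
  have "int k = (\<Sum>z\<in>Z. zorder (\<lambda>w. F w - \<zeta>) z)"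
    unfolding k_def of_nat_sum using pos by (intro sum.cong) (auto simp: Z_def less_imp_le)
  then have "2 * k \<le> N" using le[OF \<open>finite Z\<close>] by (simp add: Z_def)
  moreover have "num_solutions F D \<zeta> = enat k"
    using \<open>finite Z\<close> by (simp add: num_solutions_def Z_def[symmetric] k_def)
  ultimately show thesis using that by blast
qed

theorem theorem3p7:
  fixes \<mu> :: "real measure" and \<rho> :: "real \<Rightarrow> real" and p :: real
    and S :: "real set" and \<zeta> :: complex
  assumes "sets \<mu> = sets borel"
    and "emeasure \<mu> UNIV \<noteq> 0"
    and "compact (measure_support \<mu>)"
    and "1 < p"
    and "in_W1p p \<rho>"
    and "locally_abs_continuous \<rho>"
    and "\<And>x. \<rho> x \<ge> 0"
    and "\<mu> = density lborel (\<lambda>x. ennreal (\<rho> x))"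
    and "nowhere_dense S"
    and "\<zeta> \<notin> \<real>"
  shows "ennreal_of_enat
           (num_solutions (stieltjes \<mu>) (- complex_of_real ` measure_support \<mu>) \<zeta>)
         \<le> 1 / 2 * (SUP y \<in> {y. 0 < y \<and> y \<notin> S}. ennreal_of_enat (num_components {x. \<rho> x = y}))"
proof (cases "(SUP y \<in> {y. 0 < y \<and> y \<notin> S}. ennreal_of_enat (num_components {x. \<rho> x = y})) = top")
  case True
  show ?thesis unfolding True by (simp add: ennreal_mult_top divide_ennreal_def)
next
  case False
  define \<Gamma> where "\<Gamma> = measure_support \<mu>"
  have cont: "continuous_on UNIV \<rho>" using assms(6) by (rule locally_abs_continuous_imp_continuous)
  have outside_\<Gamma>: "\<rho> x = 0" if "x \<notin> \<Gamma>" for x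
    using density_eq_0_outside_support[OF assms(8) cont assms(7)] that by (simp add: \<Gamma>_def)
  obtain M0 where M0: "\<And>x. x \<in> \<Gamma> \<Longrightarrow> \<bar>x\<bar> \<le> M0"
    using compact_imp_bounded[OF assms(3)] by (auto simp: \<Gamma>_def bounded_iff)
  \<comment> \<open>the margin makes \<open>\<rho>\<close> vanish at \<open>-M\<close> and \<open>M\<close>\<close>
  define M where "M = \<bar>M0\<bar> + 1"
  have outside: "\<rho> x = 0" if "x \<notin> {-M<..<M}" for x
    using that M0[of x] by (intro outside_\<Gamma>) (auto simp: M_def)
  obtain g where g: "in_Lp p g" "weak_derivative \<rho> g" using assms(5) by (auto simp: in_W1p_def)
  obtain C where C: "\<And>x. \<bar>\<rho> x\<bar> \<le> C"
    using bounded_of_continuous_vanishing[OF cont, of "-M" M] outside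
    by (metis atLeastAtMost_iff greaterThanLessThan_iff less_imp_le)
  have g_int: "set_integrable lborel {a..b} g" for a b
    using in_Lp_imp_set_integrable[OF g(1) assms(4)] .
  have g_meas: "g \<in> borel_measurable borel" using g(1) by (simp add: in_Lp_def)
  interpret compact_density \<rho> g M
  proof
    show "M > 0" by (simp add: M_def)
    show "(LINT t:{a..b}|lborel. g t) = \<rho> b - \<rho> a" if "a \<le> b" for a b
      using weak_derivative_FTC[OF g(2) cont C g_int _ that] g_meas by simp
  qed (use cont outside assms(7) g_meas g_int in auto)
  define \<Phi> where "\<Phi> = log_potential g M"
  have \<Phi>_cont: "continuous_on (cball 0 r \<inter> {z. Im z \<ge> 0}) \<Phi>" if "r \<ge> 0" for r
    unfolding \<Phi>_def using M that by (intro log_potential_continuous_integrable[OF assms(4) g(1)]) auto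
  have int_pot: "set_integrable lborel {-M..M} (\<lambda>t. g t *\<^sub>R log_kernel (z - of_real t))" if "Im z \<ge> 0" for z
    using M that by (intro log_potential_continuous_integrable(2)[OF assms(4) g(1), of M "norm z"]) auto
  have cauchy_transform_\<Phi>: "cauchy_transform z = \<Phi> z" if "Im z > 0" for z
    unfolding \<Phi>_def using that int_pot[of z] by (intro cauchy_transform_eq_log_potential) auto
  have \<Phi>_holo: "\<Phi> holomorphic_on {z. Im z > 0}"
    using cauchy_transform_holomorphic by (rule holomorphic_transform) (simp add: cauchy_transform_\<Phi>)
  have bdry: "Im (\<Phi> (of_real x)) = - pi * \<rho> x" for x
    unfolding \<Phi>_def using int_pot[of "of_real x"] by (intro Im_log_potential_of_real) auto
  have decay: "\<exists>R. \<forall>z. Im z > 0 \<longrightarrow> norm z \<ge> R \<longrightarrow> norm (\<Phi> z) < e" if "e > 0" for e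
  proof (intro exI[of _ "M + (LINT t|lborel. \<rho> t) / e + 1"] allI impI)
    fix z assume z: "Im z > 0" "norm z \<ge> M + (LINT t|lborel. \<rho> t) / e + 1"
    have I: "(LINT t|lborel. \<rho> t) \<ge> 0" using assms(7) by (intro Bochner_Integration.integral_nonneg) auto
    then have "(LINT t|lborel. \<rho> t) / e \<ge> 0" using that by simp
    then have gt: "norm z - M > (LINT t|lborel. \<rho> t) / e" "norm z > M" using z by auto
    have "norm (\<Phi> z) \<le> (LINT t|lborel. \<rho> t) / (norm z - M)"
      using norm_cauchy_transform_le[of z] z gt by (simp add: cauchy_transform_\<Phi>)
    also have "\<dots> < e" using gt that by (simp add: field_simps)
    finally show "norm (\<Phi> z) < e" .
  qed

  \<comment> \<open>Since \<open>\<rho>\<close> vanishes off the support, the restriction of the integral to it can be dropped. So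
    the transform agrees with \<open>\<Phi>\<close> above the real axis, and by conjugation symmetry it is known
    below.\<close>
  have stieltjes: "stieltjes \<mu> z = (LINT t|lborel. of_real (\<rho> t) / (z - of_real t))" for z
  proof -
    have [measurable]: "\<Gamma> \<in> sets borel" using assms(3) by (simp add: \<Gamma>_def borel_compact)
    have [measurable]: "\<rho> \<in> borel_measurable borel" using cont by (rule borel_measurable_continuous_onI)
    have "stieltjes \<mu> z = (LINT t|lborel. \<rho> t *\<^sub>R (indicator \<Gamma> t *\<^sub>R (1 / (z - of_real t))))"
      unfolding stieltjes_def set_lebesgue_integral_def \<Gamma>_def[symmetric]
      by (subst assms(8), subst integral_density) (use assms(7) in auto)
    also have "\<dots> = (LINT t|lborel. of_real (\<rho> t) / (z - of_real t))"
      using outside_\<Gamma> by (intro Bochner_Integration.integral_cong) (auto simp: indicator_def scaleR_conv_of_real)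
    finally show ?thesis .
  qed
  have stieltjes_\<Phi>: "stieltjes \<mu> z = \<Phi> z" if "Im z > 0" for z
    using that by (simp add: stieltjes cauchy_transform_LINT(2) flip: cauchy_transform_\<Phi>)
  have stieltjes_cnj: "stieltjes \<mu> (cnj z) = cnj (stieltjes \<mu> z)" for z
  proof -
    have "cnj (stieltjes \<mu> z) = (LINT t|lborel. cnj (of_real (\<rho> t) / (z - of_real t)))"
      unfolding stieltjes by (simp only: Bochner_Integration.integral_cnj)
    then show ?thesis by (simp add: stieltjes)
  qed
  have Im_stieltjes: "Im (stieltjes \<mu> z) \<le> 0" if "Im z \<ge> 0" for z
  proof (cases "Im z > 0")
    case True
    have "Im (stieltjes \<mu> z) = (LINT t|lborel. Im (of_real (\<rho> t) / (z - of_real t)))"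
      unfolding stieltjes using True cauchy_transform_LINT(1)[of z]
      by (intro integral_bounded_linear[OF bounded_linear_Im, symmetric]) auto
    also have "\<dots> = - (LINT t|lborel. \<rho> t * Im z / (norm (z - of_real t))\<^sup>2)"
      by (simp add: Im_divide cmod_power2 flip: Bochner_Integration.integral_minus)
    also have "\<dots> \<le> 0" using True assms(7) by (auto intro!: Bochner_Integration.integral_nonneg)
    finally show ?thesis .
  next
    case False
    then have "cnj z = z" using that by (simp add: complex_eq_iff)
    then have "cnj (stieltjes \<mu> z) = stieltjes \<mu> z" using stieltjes_cnj[of z] by simp
    then show ?thesis by (simp add: complex_eq_iff)
  qed

  \<comment> \<open>If the supremum is finite, every admissible level set has at most \<open>N\<close> components.\<close>
  obtain b where b: "b \<ge> 0" "(SUP y \<in> {y. 0 < y \<and> y \<notin> S}. ennreal_of_enat (num_components {x. \<rho> x = y})) = ennreal b"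
    using False by (cases "SUP y \<in> {y. 0 < y \<and> y \<notin> S}. ennreal_of_enat (num_components {x. \<rho> x = y})") auto
  define N where "N = nat \<lfloor>b\<rfloor>"
  have levels: "finite (components {x. \<rho> x = y}) \<and> card (components {x. \<rho> x = y}) \<le> N" if "0 < y" "y \<notin> S" for y
  proof -
    have le: "ennreal_of_enat (num_components {x. \<rho> x = y}) \<le> ennreal b"
      unfolding b(2)[symmetric] using that by (intro SUP_upper) auto
    have "finite (components {x. \<rho> x = y})"
      using le by (rule_tac ccontr) (simp add: num_components_def top_unique)
    moreover from this have "real (card (components {x. \<rho> x = y})) \<le> b"
      using le b(1) by (simp add: num_components_def ennreal_of_nat_eq_real_of_nat)
    ultimately show ?thesis by (simp add: N_def le_nat_floor)
  qed
  define D where "D = - complex_of_real ` \<Gamma>"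
  have "\<exists>k. num_solutions (stieltjes \<mu>) D \<zeta> = enat k \<and> 2 * k \<le> N"
  proof -
    \<comment> \<open>Reflect a value in the upper half-plane: its solutions lie below the real axis, and \<open>\<sigma>\<close>
      maps them, with their multiplicities, to the solutions for the conjugate value.\<close>
    define \<zeta>m where "\<zeta>m = (if Im \<zeta> < 0 then \<zeta> else cnj \<zeta>)"
    have \<zeta>m: "Im \<zeta>m < 0" using assms(10) by (auto simp: \<zeta>m_def complex_is_Real_iff)
    have upper: "Im z > 0" if "stieltjes \<mu> z = \<zeta>m" for z
    proof (rule ccontr)
      assume "\<not> Im z > 0"
      then have "Im (stieltjes \<mu> (cnj z)) \<le> 0" by (intro Im_stieltjes) simp
      then show False using that \<zeta>m by (simp add: stieltjes_cnj)
    qed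
    obtain R where R: "\<And>z. Im z > 0 \<Longrightarrow> norm z \<ge> R \<Longrightarrow> norm (\<Phi> z) < - Im \<zeta>m"
      using decay[of "- Im \<zeta>m"] \<zeta>m by auto
    have "norm (\<Phi> (Complex 0 (\<bar>R\<bar> + 1))) < - Im \<zeta>m" by (intro R) (auto simp: cmod_def)
    then have "\<Phi> (Complex 0 (\<bar>R\<bar> + 1)) \<noteq> \<zeta>m" using abs_Im_le_cmod[of \<zeta>m] by auto
    then have nz: "\<exists>w\<in>{z. Im z > 0}. \<Phi> w - \<zeta>m \<noteq> 0"
      by (intro bexI[of _ "Complex 0 (\<bar>R\<bar> + 1)"]) auto
    define \<sigma> where "\<sigma> = (if Im \<zeta> < 0 then id else cnj)"
    have "inj \<sigma>" by (auto simp: \<sigma>_def inj_on_def)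
    have solution: "Im (\<sigma> z) > 0" "\<Phi> (\<sigma> z) = \<zeta>m"
      "zorder (\<lambda>w. stieltjes \<mu> w - \<zeta>) z = zorder (\<lambda>w. \<Phi> w - \<zeta>m) (\<sigma> z)"
      if z: "stieltjes \<mu> z = \<zeta>" for z
    proof -
      have "stieltjes \<mu> (\<sigma> z) = \<zeta>m" using z by (simp add: \<sigma>_def \<zeta>m_def stieltjes_cnj)
      then show \<sigma>z: "Im (\<sigma> z) > 0" by (rule upper)
      then show "\<Phi> (\<sigma> z) = \<zeta>m" using \<open>stieltjes \<mu> (\<sigma> z) = \<zeta>m\<close> stieltjes_\<Phi> by simp
      show "zorder (\<lambda>w. stieltjes \<mu> w - \<zeta>) z = zorder (\<lambda>w. \<Phi> w - \<zeta>m) (\<sigma> z)"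
      proof (cases "Im \<zeta> < 0")
        case True
        then have "Im z > 0" using \<sigma>z by (simp add: \<sigma>_def)
        then have "\<forall>\<^sub>F w in nhds z. Im w > 0"
          using eventually_nhds_in_open[of "{z. Im z > 0}" z] by (simp add: open_halfspace_Im_gt)
        then have "\<forall>\<^sub>F w in at z. stieltjes \<mu> w - \<zeta> = \<Phi> w - \<zeta>m"
          unfolding eventually_at_filter
          by eventually_elim (use True in \<open>simp add: stieltjes_\<Phi> \<zeta>m_def\<close>)
        then show ?thesis using True by (simp add: \<sigma>_def zorder_cong)
      next
        case False
        have "zorder (\<lambda>w. stieltjes \<mu> w - \<zeta>) (cnj (\<sigma> z)) = zorder (\<lambda>w. \<Phi> w - \<zeta>m) (\<sigma> z)"
        proof (rule zorder_cnj_symmetric[where A = "{z. Im z > 0}"])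
          show "(\<lambda>w. \<Phi> w - \<zeta>m) holomorphic_on {z. Im z > 0}"
            by (intro holomorphic_intros \<Phi>_holo)
          fix w assume "w \<in> {z. Im z > 0}"
          then show "stieltjes \<mu> (cnj w) - \<zeta> = cnj (\<Phi> w - \<zeta>m)"
            using False stieltjes_\<Phi>[of w] by (simp add: stieltjes_cnj \<zeta>m_def)
        qed (use \<sigma>z nz in \<open>auto simp: open_halfspace_Im_gt convex_halfspace_Im_gt convex_connected\<close>)
        then show ?thesis using False by (simp add: \<sigma>_def)
      qed
    qed
    note count = zero_count_le_half_level_components[OF \<Phi>_cont \<Phi>_holo bdry decay outside assms(9) levels \<zeta>m]
    show ?thesis
    proof (rule num_solutions_leI)
      show "zorder (\<lambda>w. stieltjes \<mu> w - \<zeta>) z > 0" if "stieltjes \<mu> z = \<zeta>" for z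
        using count(2)[where T = "{\<sigma> z}"] solution[OF that] by simp
      fix T assume T: "finite T" "T \<subseteq> {z \<in> D. stieltjes \<mu> z = \<zeta>}"
      have "(\<Sum>z\<in>T. zorder (\<lambda>w. stieltjes \<mu> w - \<zeta>) z) = (\<Sum>z\<in>T. zorder (\<lambda>w. \<Phi> w - \<zeta>m) (\<sigma> z))"
        using T(2) solution(3) by (intro sum.cong) auto
      also have "\<dots> = (\<Sum>z\<in>\<sigma> ` T. zorder (\<lambda>w. \<Phi> w - \<zeta>m) z)"
        using inj_on_subset[OF \<open>inj \<sigma>\<close>] by (subst sum.reindex) auto
      finally show "2 * (\<Sum>z\<in>T. zorder (\<lambda>w. stieltjes \<mu> w - \<zeta>) z) \<le> int N"
        using count(1)[where T = "\<sigma> ` T"] T solution(1,2) by fastforce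
    qed blast
  qed
  then obtain k where k: "num_solutions (stieltjes \<mu>) D \<zeta> = enat k" "2 * k \<le> N" by blast
  have "real k \<le> b / 2"
    using k(2) b(1) unfolding N_def by linarith
  then have "ennreal (real k) \<le> ennreal (1 / 2 * b)" by (intro ennreal_leI) simp
  also have "\<dots> = 1 / 2 * ennreal b"
    using b(1) ennreal_divide_numeral[of 1 "Num.Bit0 Num.One"] by (simp only: ennreal_mult ennreal_1 zero_le_one divide_nonneg_pos zero_less_numeral simp_thms zero_le_divide_1_iff zero_le_numeral)
  finally show ?thesis
    unfolding b(2) k(1)[unfolded D_def \<Gamma>_def] by (simp add: ennreal_of_nat_eq_real_of_nat)
qed

end
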